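(* Let $(G,X)$ be a flow, where $G$ is compactly generated by $\Gamma$ and $\dim X=0$. Then the following conditions are pairwise equivalent: (1) $(G,X)$ is pointwise $\Gamma$-recurrent of type I. (2) $(G,X)$ is pointwise $\Gamma$-recurrent of type II. (3) $(G,X)$ is pointwise almost periodic. (4) $X$ is a union of $G$-minimal sets. (5) $R_o(X)=\{(x,y)\in X\times X: y\in\overline{Gx}\}$ is closed in $X\times X$. (6) $\mathscr{O}_G\colon X\to2^X$, $x\mapsto\overline{Gx}$, is $\ulcorner$continuous$\urcorner$ on $X$. (7) $\mathscr{O}_G$ is upper semi-continuous on $X$. (8) For every compact-open subset $U$ of $X$, the set $U_G^*=\{x\in X:\overline{Gx}\subseteq U\}$ is compact and open. (9) $(G,X)$ is locally weakly almost periodic with $G$ under the discrete topology.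
   Context: A Hausdorff para-topological group is a group with a Hausdorff topology for which multiplication $G\times G\to G$ is jointly continuous (inversion need not be continuous). A flow $(G,X)$ consists of a Hausdorff para-topological group $G$, a locally compact Hausdorff uniform space $X$ (uniformity $\mathscr{U}$), and a jointly continuous map $G\times X\to X$, $(t,x)\mapsto tx$, with $ex=x$ and $(st)x=s(tx)$, such that $\overline{Gx}$ is compact for every $x\in X$. $\mathfrak{N}_x$ is the neighborhood filter of $x$; $N_G(x,U)=\{t\in G: tx\in U\}$; $\alpha[x]=\{y:(x,y)\in\alpha\}$. $\dim X=0$ means $X$ has a base of clopen sets. $G$ is compactly generated by $\Gamma$ if $\Gamma\subseteq G$ is compact, $e\in\Gamma=\Gamma^{-1}$ and $G=\bigcup_{r\ge1}\Gamma^r$. For a Hausdorff space $Y$, $2^Y$ is the collection of closed subsets; for a net $\{Y_i\}$ in $2^Y$, write $Y_i\rightharpoonup K$ if $K$ is the set of all $y\in Y$ for which there are a subnet $\{Y_{i_k}\}$ and $y_{i_k}\in Y_{i_k}$ with $y_{i_k}\to y$. For $g\ne e$ in $G$, $|g|$ is the least $r$ with $g\in\Gamma^r$, and $\boldsymbol{K}(g)=\Gamma^{|g|-1}g$ with $\Gamma^0=\{e\}$. A $\Gamma$-cone is a set $\boldsymbol{C}\subseteq G$ such that $\boldsymbol{K}(g_i)\rightharpoonup\boldsymbol{C}$ in $2^G$ for some net $\{g_i\}$ in $G\setminus\{e\}$ with $|g_i|\to\infty$ and $|g_i|\le|g_{i'}|$ whenever $i\le i'$. A point $x$ is $\Gamma$-recurrent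 of type I if $\boldsymbol{C}x\cap U\ne\emptyset$ for every $\Gamma$-cone $\boldsymbol{C}$ and every $U\in\mathfrak{N}_x$. A point $x$ is $\Gamma$-recurrent of type II if for every $U\in\mathfrak{N}_x$ and every net $\{g_i\}$ in $G\setminus\{e\}$ with $|g_i|\to\infty$ there are an integer $n\ge1$, a subnet $\{g_{i_j}\}$ and $c_j\in\boldsymbol{K}(g_{i_j})$ with $c_jx\in U$ and $|c_j|\le n$. "Pointwise" means that the property holds at every point of $X$. $A\subseteq G$ is syndetic if $G=K^{-1}A$ for some compact $K\subseteq G$. A point $x$ is almost periodic if $N_G(x,U)$ is syndetic for all $U\in\mathfrak{N}_x$. A set $K\subseteq X$ is minimal if $\overline{Gx}=K$ for all $x\in K$. $(G,X)$ is locally weakly almost periodic with $G$ under the discrete topology if for every $\alpha\in\mathscr{U}$ and $x\in X$ there are a finite $F\subseteq G$ and $V\in\mathfrak{N}_x$ with $Fty\cap\alpha[y]\neq\emptyset$ for all $y\in V$, $t\in G$. $\mathscr{O}_G$ is $\ulcorner$continuous$\urcorner$ if $x_i\to x$ in $X$ implies $\overline{Gx_i}\rightharpoonup\overline{Gx}$ in $2^X$. $\mathscr{O}_G$ is upper semi-continuous if for every $x\in X$ and every neighborhood $U$ of $\overline{Gx}$ there is $V\in\mathfrak{N}_x$ with $\overline{Gy}\subseteq U$ for all $y\in V$. *)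

theory Defs
  imports "HOL-Analysis.Analysis" "HOL-Library.Set_Algebras"
begin

section \<open>Para-topological groups and flows\<close>

text \<open>
  Only multiplication is required to be continuous.  The type class \<open>inverse\<close> brings along a
  division operation, which the last axiom pins down.
\<close>

class paratopological_group = topological_monoid_mult + t2_space + inverse +
  assumes inverse_mult_self: "inverse a * a = 1"
    and divide_conv_mult_inverse: "a / b = a * inverse b"

definition orbit_closure ::
    "('g::paratopological_group \<Rightarrow> 'x \<Rightarrow> 'x::topological_space) \<Rightarrow> 'x \<Rightarrow> 'x set" where
  "orbit_closure act x = closure (range (\<lambda>t. act t x))"

definition flow ::
    "('g::paratopological_group \<Rightarrow> 'x \<Rightarrow> 'x::{uniform_space,t2_space}) \<Rightarrow> bool" where
  "flow act \<longleftrightarrow>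
     locally_compact_space (euclidean :: 'x topology) \<and>
     continuous_on UNIV (\<lambda>(t, x). act t x) \<and>
     (\<forall>x. act 1 x = x) \<and>
     (\<forall>s t x. act (s * t) x = act s (act t x)) \<and>
     (\<forall>x. compact (orbit_closure act x))"

definition zero_dimensional :: "'x::topological_space itself \<Rightarrow> bool" where
  "zero_dimensional _ \<longleftrightarrow>
     (\<exists>B :: 'x set set. topological_basis B \<and> (\<forall>U\<in>B. open U \<and> closed U))"

text \<open>
  Products and powers of sets are those of \<open>HOL-Library.Set_Algebras\<close>; in particular
  \<open>\<Gamma> ^ 0 = {1}\<close>.
\<close>

definition compactly_generated_by :: "'g::paratopological_group set \<Rightarrow> bool" where
  "compactly_generated_by \<Gamma> \<longleftrightarrow>
     compact \<Gamma> \<and> 1 \<in> \<Gamma> \<and> inverse ` \<Gamma> = \<Gamma> \<and> (\<Union>r\<in>{1..}. \<Gamma> ^ r) = UNIV"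


section \<open>Nets\<close>

definition directed_set :: "'i set \<Rightarrow> ('i \<Rightarrow> 'i \<Rightarrow> bool) \<Rightarrow> bool" where
  "directed_set I le \<longleftrightarrow>
     I \<noteq> {} \<and> reflp_on I le \<and> transp_on I le \<and> (\<forall>i\<in>I. \<forall>j\<in>I. \<exists>k\<in>I. le i k \<and> le j k)"

text \<open>
  The filter of tails.  A net \<open>a\<close> indexed by \<open>I\<close> converges to \<open>l\<close> iff
  \<open>(a \<longlongrightarrow> l) (net_filter I le)\<close>.
\<close>

definition net_filter :: "'i set \<Rightarrow> ('i \<Rightarrow> 'i \<Rightarrow> bool) \<Rightarrow> 'i filter" where
  "net_filter I le = (INF i\<in>I. principal {j \<in> I. le i j})"

definition subnet_map ::
    "'i set \<Rightarrow> ('i \<Rightarrow> 'i \<Rightarrow> bool) \<Rightarrow> 'j set \<Rightarrow> ('j \<Rightarrow> 'j \<Rightarrow> bool) \<Rightarrow> ('j \<Rightarrow> 'i) \<Rightarrow> bool" where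
  "subnet_map I le J le' \<phi> \<longleftrightarrow>
     directed_set J le' \<and> \<phi> \<in> J \<rightarrow> I \<and>
     (\<forall>i\<in>I. \<exists>j\<in>J. \<forall>k\<in>J. le' j k \<longrightarrow> le i (\<phi> k))"

text \<open>
  In HOL a definition cannot quantify over all index types of nets.  Nets in \<open>'a\<close> are indexed
  below by directed subsets of \<open>'a \<times> 'a set\<close>, and the subnets in \<open>set_net_limit\<close> by directed
  subsets of \<open>'i \<times> 'y set\<close>.  These types are large enough: the lemmas \<open>set_net_limit_iff\<close>,
  \<open>mem_set_net_limit_any_index\<close>, \<open>gamma_cone_any_index\<close>, \<open>gamma_recurrent_II_any_index\<close>,
  \<open>gamma_recurrent_II_any_subnet_index\<close> and \<open>orbit_closure_continuous_any_index\<close> below show that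
  admitting arbitrary index types gives the same notions.
\<close>

type_synonym 'a net_index = "'a \<times> 'a set"

text \<open>
  \<open>set_net_limit I le Y K\<close> renders \<open>Y\<^sub>i \<rightharpoonup> K\<close>.  It is applied only to nets of closed sets, and
  \<open>K\<close> is then closed too.
\<close>

definition set_net_limit ::
    "'i set \<Rightarrow> ('i \<Rightarrow> 'i \<Rightarrow> bool) \<Rightarrow> ('i \<Rightarrow> 'y set) \<Rightarrow> 'y::topological_space set \<Rightarrow> bool" where
  "set_net_limit I le Y K \<longleftrightarrow>
     K = {y. \<exists>(J :: ('i \<times> 'y set) set) le' \<phi> s.
               subnet_map I le J le' \<phi> \<and> (\<forall>j\<in>J. s j \<in> Y (\<phi> j)) \<and>
               (s \<longlongrightarrow> y) (net_filter J le')}"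


section \<open>Cones and recurrence\<close>

definition gamma_length :: "'g::paratopological_group set \<Rightarrow> 'g \<Rightarrow> nat" where
  "gamma_length \<Gamma> g = (LEAST r. g \<in> \<Gamma> ^ r)"

definition gamma_K :: "'g::paratopological_group set \<Rightarrow> 'g \<Rightarrow> 'g set" where
  "gamma_K \<Gamma> g = \<Gamma> ^ (gamma_length \<Gamma> g - 1) * {g}"

definition gamma_cone :: "'g::paratopological_group set \<Rightarrow> 'g set \<Rightarrow> bool" where
  "gamma_cone \<Gamma> C \<longleftrightarrow>
     (\<exists>(I :: 'g net_index set) le g.
        directed_set I le \<and> g \<in> I \<rightarrow> - {1} \<and>
        filterlim (\<lambda>i. gamma_length \<Gamma> (g i)) at_top (net_filter I le) \<and>
        (\<forall>i\<in>I. \<forall>i'\<in>I. le i i' \<longrightarrow> gamma_length \<Gamma> (g i) \<le> gamma_length \<Gamma> (g i')) \<and>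
        set_net_limit I le (\<lambda>i. gamma_K \<Gamma> (g i)) C)"

definition gamma_recurrent_I ::
    "('g::paratopological_group \<Rightarrow> 'x \<Rightarrow> 'x::topological_space) \<Rightarrow> 'g set \<Rightarrow> 'x \<Rightarrow> bool" where
  "gamma_recurrent_I act \<Gamma> x \<longleftrightarrow>
     (\<forall>C U. gamma_cone \<Gamma> C \<longrightarrow> x \<in> interior U \<longrightarrow> (\<lambda>c. act c x) ` C \<inter> U \<noteq> {})"

definition gamma_recurrent_II ::
    "('g::paratopological_group \<Rightarrow> 'x \<Rightarrow> 'x::topological_space) \<Rightarrow> 'g set \<Rightarrow> 'x \<Rightarrow> bool" where
  "gamma_recurrent_II act \<Gamma> x \<longleftrightarrow>
     (\<forall>U (I :: 'g net_index set) le g.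
        x \<in> interior U \<longrightarrow> directed_set I le \<longrightarrow> g \<in> I \<rightarrow> - {1} \<longrightarrow>
        filterlim (\<lambda>i. gamma_length \<Gamma> (g i)) at_top (net_filter I le) \<longrightarrow>
        (\<exists>n\<ge>1. \<exists>(J :: 'g net_index set) le' \<phi> c.
           subnet_map I le J le' \<phi> \<and>
           (\<forall>j\<in>J. c j \<in> gamma_K \<Gamma> (g (\<phi> j)) \<and> act (c j) x \<in> U \<and> gamma_length \<Gamma> (c j) \<le> n)))"


section \<open>Almost periodicity, minimal sets and orbit closures\<close>

definition syndetic :: "'g::paratopological_group set \<Rightarrow> bool" where
  "syndetic A \<longleftrightarrow> (\<exists>K. compact K \<and> (inverse ` K) * A = UNIV)"

definition almost_periodic ::
    "('g::paratopological_group \<Rightarrow> 'x \<Rightarrow> 'x::topological_space) \<Rightarrow> 'x \<Rightarrow> bool" where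
  "almost_periodic act x \<longleftrightarrow> (\<forall>U. x \<in> interior U \<longrightarrow> syndetic {t. act t x \<in> U})"

definition minimal_set ::
    "('g::paratopological_group \<Rightarrow> 'x \<Rightarrow> 'x::topological_space) \<Rightarrow> 'x set \<Rightarrow> bool" where
  "minimal_set act K \<longleftrightarrow> (\<forall>x\<in>K. orbit_closure act x = K)"

definition orbit_closure_continuous ::
    "('g::paratopological_group \<Rightarrow> 'x \<Rightarrow> 'x::topological_space) \<Rightarrow> bool" where
  "orbit_closure_continuous act \<longleftrightarrow>
     (\<forall>(I :: 'x net_index set) le a x.
        directed_set I le \<longrightarrow> (a \<longlongrightarrow> x) (net_filter I le) \<longrightarrow>
        set_net_limit I le (\<lambda>i. orbit_closure act (a i)) (orbit_closure act x))"

definition orbit_closure_usc ::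
    "('g::paratopological_group \<Rightarrow> 'x \<Rightarrow> 'x::topological_space) \<Rightarrow> bool" where
  "orbit_closure_usc act \<longleftrightarrow>
     (\<forall>x U. orbit_closure act x \<subseteq> interior U \<longrightarrow>
        (\<exists>V. x \<in> interior V \<and> (\<forall>y\<in>V. orbit_closure act y \<subseteq> U)))"

definition discrete_locally_weakly_almost_periodic ::
    "('g::paratopological_group \<Rightarrow> 'x \<Rightarrow> 'x::uniform_space) \<Rightarrow> bool" where
  "discrete_locally_weakly_almost_periodic act \<longleftrightarrow>
     (\<forall>\<alpha> x. eventually (\<lambda>p. p \<in> \<alpha>) uniformity \<longrightarrow>
        (\<exists>F V. finite F \<and> x \<in> interior V \<and>
           (\<forall>y\<in>V. \<forall>t. (\<lambda>f. act f (act t y)) ` F \<inter> \<alpha> `` {y} \<noteq> {})))"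


section \<open>Independence of the index types\<close>

lemma eventually_net_filter:
  assumes "directed_set I le"
  shows "eventually P (net_filter I le) \<longleftrightarrow> (\<exists>i\<in>I. \<forall>j\<in>I. le i j \<longrightarrow> P j)"
proof -
  have "eventually P (net_filter I le) \<longleftrightarrow> (\<exists>i\<in>I. eventually P (principal {j \<in> I. le i j}))"
    unfolding net_filter_def
  proof (rule eventually_INF_base)
    show "I \<noteq> {}" using assms by (simp add: directed_set_def)
  next
    fix a b assume ab: "a \<in> I" "b \<in> I"
    then obtain k where k: "k \<in> I" "le a k" "le b k"
      using assms by (auto simp: directed_set_def)
    have tr: "transp_on I le" using assms by (simp add: directed_set_def)
    have "{j \<in> I. le k j} \<subseteq> {j \<in> I. le a j} \<inter> {j \<in> I. le b j}"
      using k ab transp_onD[OF tr] by blast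
    then show "\<exists>x\<in>I. principal {j \<in> I. le x j}
        \<le> inf (principal {j \<in> I. le a j}) (principal {j \<in> I. le b j})"
      using k by auto
  qed
  then show ?thesis by (auto simp: eventually_principal)
qed

lemma frequently_net_filter:
  assumes "directed_set I le"
  shows "frequently P (net_filter I le) \<longleftrightarrow> (\<forall>i\<in>I. \<exists>j\<in>I. le i j \<and> P j)"
  unfolding frequently_def eventually_net_filter[OF assms] by blast

lemma subnet_imp_frequently:
  assumes sub: "subnet_map I le J le' \<phi>" and dir: "directed_set I le"
    and P: "eventually (\<lambda>j. P (\<phi> j)) (net_filter J le')"
  shows "frequently P (net_filter I le)"
  unfolding frequently_net_filter[OF dir]
proof
  fix i assume i: "i \<in> I"
  have dJ: "directed_set J le'" and \<phi>: "\<phi> \<in> J \<rightarrow> I" using sub by (auto simp: subnet_map_def)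
  obtain j where j: "j \<in> J" "\<forall>k\<in>J. le' j k \<longrightarrow> le i (\<phi> k)"
    using sub i by (auto simp: subnet_map_def)
  obtain l where l: "l \<in> J" "\<forall>k\<in>J. le' l k \<longrightarrow> P (\<phi> k)"
    using P unfolding eventually_net_filter[OF dJ] by blast
  obtain k where "k \<in> J" "le' j k" "le' l k"
    using dJ j l unfolding directed_set_def by blast
  then show "\<exists>j\<in>I. le i j \<and> P j" using j l \<phi> by blast
qed

lemma frequently_imp_subnet:
  assumes dir: "directed_set I le" and P: "frequently P (net_filter I le)"
  shows "subnet_map I le {i \<in> I. P i} le (\<lambda>i. i)"
proof -
  have *: "\<forall>i\<in>I. \<exists>j\<in>I. le i j \<and> P j" using P frequently_net_filter[OF dir] by blast
  have d: "I \<noteq> {}" "reflp_on I le" "transp_on I le"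
    "\<And>i j. i \<in> I \<Longrightarrow> j \<in> I \<Longrightarrow> \<exists>k\<in>I. le i k \<and> le j k"
    using dir by (auto simp: directed_set_def)
  have "directed_set {i \<in> I. P i} le"
    unfolding directed_set_def
  proof (intro conjI ballI)
    show "{i \<in> I. P i} \<noteq> {}" using * d(1) by blast
    show "reflp_on {i \<in> I. P i} le" using d(2) by (auto simp: reflp_on_def)
    show "transp_on {i \<in> I. P i} le" using d(3) by (auto simp: transp_on_def)
  next
    fix i j assume ij: "i \<in> {i \<in> I. P i}" "j \<in> {i \<in> I. P i}"
    then obtain k where k: "k \<in> I" "le i k" "le j k" using d(4) by blast
    obtain l where l: "l \<in> I" "le k l" "P l" using * k by blast
    have "le i l" "le j l" using transp_onD[OF d(3)] ij k l by blast+
    then show "\<exists>k\<in>{i \<in> I. P i}. le i k \<and> le j k" using l by blast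
  qed
  moreover have "\<exists>j\<in>{i \<in> I. P i}. \<forall>k\<in>{i \<in> I. P i}. le j k \<longrightarrow> le i k" if i: "i \<in> I" for i
  proof -
    obtain j where j: "j \<in> I" "le i j" "P j" using * i by blast
    have "le i k" if "k \<in> I" "le j k" for k using transp_onD[OF d(3)] i j that by blast
    then show ?thesis using j by blast
  qed
  ultimately show ?thesis by (auto simp: subnet_map_def)
qed

lemma set_net_limit_iff:
  fixes Y :: "'i \<Rightarrow> 'y::topological_space set"
  assumes dir: "directed_set I le"
  shows "set_net_limit I le Y K \<longleftrightarrow>
    K = {y. \<forall>U. open U \<longrightarrow> y \<in> U \<longrightarrow> (\<exists>\<^sub>F i in net_filter I le. Y i \<inter> U \<noteq> {})}"
proof -
  have "(\<exists>(J :: ('i \<times> 'y set) set) le' \<phi> s.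
          subnet_map I le J le' \<phi> \<and> (\<forall>j\<in>J. s j \<in> Y (\<phi> j)) \<and> (s \<longlongrightarrow> y) (net_filter J le'))
    \<longleftrightarrow> (\<forall>U. open U \<longrightarrow> y \<in> U \<longrightarrow> (\<exists>\<^sub>F i in net_filter I le. Y i \<inter> U \<noteq> {}))" (is "?L \<longleftrightarrow> ?R") for y
  proof
    assume ?L
    then obtain J :: "('i \<times> 'y set) set" and le' \<phi> s where
      sub: "subnet_map I le J le' \<phi>" and s: "\<forall>j\<in>J. s j \<in> Y (\<phi> j)"
      and lim: "(s \<longlongrightarrow> y) (net_filter J le')" by blast
    have dJ: "directed_set J le'" using sub by (auto simp: subnet_map_def)
    show ?R
    proof (intro allI impI)
      fix U assume "open U" "y \<in> U"
      then have "eventually (\<lambda>j. s j \<in> U) (net_filter J le')" using lim topological_tendstoD by blast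
      then have "eventually (\<lambda>j. Y (\<phi> j) \<inter> U \<noteq> {}) (net_filter J le')"
        using s unfolding eventually_net_filter[OF dJ] by blast
      then show "\<exists>\<^sub>F i in net_filter I le. Y i \<inter> U \<noteq> {}"
        by (rule subnet_imp_frequently[OF sub dir])
    qed
  next
    assume R: ?R
    then have R': "\<And>U i. open U \<Longrightarrow> y \<in> U \<Longrightarrow> i \<in> I \<Longrightarrow> \<exists>j\<in>I. le i j \<and> Y j \<inter> U \<noteq> {}"
      unfolding frequently_net_filter[OF dir] by blast
    have d: "I \<noteq> {}" "reflp_on I le" "transp_on I le"
      "\<And>i j. i \<in> I \<Longrightarrow> j \<in> I \<Longrightarrow> \<exists>k\<in>I. le i k \<and> le j k"
      using dir by (auto simp: directed_set_def)
    define J where "J = {(i, U). i \<in> I \<and> open U \<and> y \<in> U \<and> Y i \<inter> U \<noteq> {}}"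
    define le' where "le' = (\<lambda>p q. le (fst p) (fst q) \<and> snd q \<subseteq> (snd p :: 'y set))"
    define s where "s = (\<lambda>p. SOME z. z \<in> Y (fst p) \<inter> snd p)"
    have s: "s p \<in> Y (fst p)" "s p \<in> snd p" if "p \<in> J" for p
    proof -
      have "\<exists>z. z \<in> Y (fst p) \<inter> snd p" using that by (auto simp: J_def)
      then have "s p \<in> Y (fst p) \<inter> snd p" unfolding s_def by (rule someI_ex)
      then show "s p \<in> Y (fst p)" "s p \<in> snd p" by auto
    qed
    obtain i0 where i0: "i0 \<in> I" using d(1) by blast
    have dJ: "directed_set J le'"
      unfolding directed_set_def
    proof (intro conjI ballI)
      obtain j where "j \<in> I" "Y j \<inter> UNIV \<noteq> {}" using R'[of UNIV i0] i0 by auto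
      then have "(j, UNIV) \<in> J" by (auto simp: J_def)
      then show "J \<noteq> {}" by blast
      show "reflp_on J le'" using d(2) by (auto simp: reflp_on_def J_def le'_def)
      show "transp_on J le'"
      proof (rule transp_onI)
        fix p q r assume "p \<in> J" "q \<in> J" "r \<in> J" "le' p q" "le' q r"
        then show "le' p r" using transp_onD[OF d(3), of "fst p" "fst q" "fst r"]
          by (auto simp: J_def le'_def)
      qed
    next
      fix p q assume pq: "p \<in> J" "q \<in> J"
      then have I: "fst p \<in> I" "fst q \<in> I" by (auto simp: J_def)
      then obtain k where k: "k \<in> I" "le (fst p) k" "le (fst q) k" using d(4) by blast
      have "open (snd p \<inter> snd q)" "y \<in> snd p \<inter> snd q" using pq by (auto simp: J_def)
      from R'[OF this k(1)] obtain l where l: "l \<in> I" "le k l" "Y l \<inter> (snd p \<inter> snd q) \<noteq> {}"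
        by blast
      have "le (fst p) l" "le (fst q) l" using transp_onD[OF d(3)] I k l by blast+
      moreover have "(l, snd p \<inter> snd q) \<in> J" using pq l by (auto simp: J_def)
      ultimately show "\<exists>r\<in>J. le' p r \<and> le' q r"
        by (intro bexI[of _ "(l, snd p \<inter> snd q)"]) (auto simp: le'_def)
    qed
    have "subnet_map I le J le' fst"
      unfolding subnet_map_def
    proof (intro conjI ballI)
      show "fst \<in> J \<rightarrow> I" by (auto simp: J_def)
      fix i assume i: "i \<in> I"
      obtain j where j: "j \<in> I" "le i j" "Y j \<inter> UNIV \<noteq> {}" using R'[of UNIV i] i by auto
      have "(j, UNIV) \<in> J" using j by (auto simp: J_def)
      moreover have "le i (fst p)" if "p \<in> J" "le' (j, UNIV) p" for p
        using that i j transp_onD[OF d(3), of i j "fst p"] by (auto simp: J_def le'_def)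
      ultimately show "\<exists>j\<in>J. \<forall>k\<in>J. le' j k \<longrightarrow> le i (fst k)" by blast
    qed (rule dJ)
    moreover have "(s \<longlongrightarrow> y) (net_filter J le')"
    proof (rule topological_tendstoI)
      fix U assume U: "open U" "y \<in> U"
      obtain j where j: "j \<in> I" "Y j \<inter> U \<noteq> {}" using R'[OF U i0] by auto
      then have "(j, U) \<in> J" using U by (auto simp: J_def)
      moreover have "s p \<in> U" if "p \<in> J" "le' (j, U) p" for p
        using s(2)[OF that(1)] that(2) by (auto simp: le'_def)
      ultimately show "eventually (\<lambda>p. s p \<in> U) (net_filter J le')"
        unfolding eventually_net_filter[OF dJ] by blast
    qed
    ultimately show ?L using s(1) by blast
  qed
  then show ?thesis unfolding set_net_limit_def by simp
qed

lemma mem_set_net_limit_any_index: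
  fixes J :: "'j set" and Y :: "'i \<Rightarrow> 'y::topological_space set"
  assumes dir: "directed_set I le" and K: "set_net_limit I le Y K"
    and sub: "subnet_map I le J le' \<phi>" and s: "\<forall>j\<in>J. s j \<in> Y (\<phi> j)"
    and lim: "(s \<longlongrightarrow> y) (net_filter J le')"
  shows "y \<in> K"
proof -
  have dJ: "directed_set J le'" using sub by (auto simp: subnet_map_def)
  have "\<exists>\<^sub>F i in net_filter I le. Y i \<inter> U \<noteq> {}" if "open U" "y \<in> U" for U
  proof -
    have "eventually (\<lambda>j. s j \<in> U) (net_filter J le')" using lim that topological_tendstoD by blast
    then have "eventually (\<lambda>j. Y (\<phi> j) \<inter> U \<noteq> {}) (net_filter J le')"
      using s unfolding eventually_net_filter[OF dJ] by blast
    then show ?thesis by (rule subnet_imp_frequently[OF sub dir])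
  qed
  then show ?thesis using K unfolding set_net_limit_iff[OF dir] by blast
qed

lemma net_reindex:
  fixes I :: "'i set" and a :: "'i \<Rightarrow> 'a" and N :: "'a \<Rightarrow> nat"
  assumes dir: "directed_set I le"
    and N: "\<And>j. j \<in> I \<Longrightarrow> eventually (\<lambda>i. N (a j) \<le> N (a i)) (net_filter I le)"
  obtains J :: "'a net_index set" and le' where
    "directed_set J le'" "fst \<in> J \<rightarrow> a ` I"
    "\<forall>p\<in>J. \<forall>q\<in>J. le' p q \<longrightarrow> N (fst p) \<le> N (fst q)"
    "filtermap fst (net_filter J le') = filtermap a (net_filter I le)"
proof -
  define E where "E = (\<lambda>A. A \<subseteq> a ` I \<and> eventually (\<lambda>i. a i \<in> A) (net_filter I le))"
  define J where "J = {(x, A). E A \<and> x \<in> A}"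
  define le' where "le' = (\<lambda>p q. snd q \<subseteq> (snd p :: 'a set) \<and> N (fst p) \<le> N (fst q))"
  have d: "I \<noteq> {}" using dir by (auto simp: directed_set_def)
  have ne: "A \<noteq> {}" if "E A" for A
    using that dir unfolding E_def eventually_net_filter[OF dir]
    by (auto simp: directed_set_def reflp_on_def)
  have EN: "E (A \<inter> {x. N y \<le> N x})" if "E A" "y \<in> a ` I" for A y
    using that N unfolding E_def by (auto intro: eventually_conj)
  have EI: "E (a ` I)" unfolding E_def eventually_net_filter[OF dir] using d by auto
  have dJ: "directed_set J le'"
    unfolding directed_set_def
  proof (intro conjI ballI)
    show "J \<noteq> {}" using EI ne[OF EI] by (auto simp: J_def)
    show "reflp_on J le'" by (auto simp: reflp_on_def le'_def)
    show "transp_on J le'" unfolding transp_on_def le'_def by (meson order_trans subset_trans)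
  next
    fix p q assume pq: "p \<in> J" "q \<in> J"
    define A where "A = snd p \<inter> snd q \<inter> {x. N (fst p) \<le> N x} \<inter> {x. N (fst q) \<le> N x}"
    have "E (snd p \<inter> snd q)" using pq by (auto simp: J_def E_def eventually_conj)
    moreover have "fst p \<in> a ` I" "fst q \<in> a ` I" using pq by (auto simp: J_def E_def)
    ultimately have A: "E A" unfolding A_def by (intro EN)
    then obtain x where "x \<in> A" using ne by blast
    then have "(x, A) \<in> J" "le' p (x, A)" "le' q (x, A)" using A
      by (auto simp: J_def le'_def A_def)
    then show "\<exists>r\<in>J. le' p r \<and> le' q r" by blast
  qed
  have "eventually P (filtermap fst (net_filter J le')) \<longleftrightarrow>
        eventually P (filtermap a (net_filter I le))" for P
  proof
    assume "eventually P (filtermap fst (net_filter J le'))"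
    then obtain p where p: "p \<in> J" "\<forall>q\<in>J. le' p q \<longrightarrow> P (fst q)"
      unfolding eventually_filtermap eventually_net_filter[OF dJ] by blast
    define A where "A = snd p \<inter> {x. N (fst p) \<le> N x}"
    have A: "E A" unfolding A_def using p(1) by (intro EN) (auto simp: J_def E_def)
    have "P x" if "x \<in> A" for x
    proof -
      have "(x, A) \<in> J" "le' p (x, A)" using A that by (auto simp: J_def le'_def A_def)
      then show ?thesis using p(2) by force
    qed
    then show "eventually P (filtermap a (net_filter I le))"
      using A unfolding eventually_filtermap E_def by (auto elim: eventually_mono)
  next
    assume P: "eventually P (filtermap a (net_filter I le))"
    have A: "E {x \<in> a ` I. P x}"
      using P unfolding E_def eventually_filtermap eventually_net_filter[OF dir] by auto
    then obtain x where x: "x \<in> {x \<in> a ` I. P x}" using ne by blast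
    have "(x, {x \<in> a ` I. P x}) \<in> J" using A x by (auto simp: J_def)
    moreover have "P (fst q)" if "q \<in> J" "le' (x, {x \<in> a ` I. P x}) q" for q
      using that by (auto simp: J_def le'_def)
    ultimately show "eventually P (filtermap fst (net_filter J le'))"
      unfolding eventually_filtermap eventually_net_filter[OF dJ] by blast
  qed
  then have "filtermap fst (net_filter J le') = filtermap a (net_filter I le)"
    by (simp add: filter_eq_iff)
  moreover have "fst \<in> J \<rightarrow> a ` I" by (auto simp: J_def E_def)
  moreover have "\<forall>p\<in>J. \<forall>q\<in>J. le' p q \<longrightarrow> N (fst p) \<le> N (fst q)" by (auto simp: le'_def)
  ultimately show ?thesis using that dJ by blast
qed

lemma frequently_reindex:
  assumes "filtermap b G = filtermap a F"
  shows "(\<exists>\<^sub>F j in G. P (b j)) \<longleftrightarrow> (\<exists>\<^sub>F i in F. P (a i))"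
proof -
  have "eventually (\<lambda>x. \<not> P x) (filtermap b G) \<longleftrightarrow> eventually (\<lambda>x. \<not> P x) (filtermap a F)"
    by (simp only: assms)
  then show ?thesis by (simp add: frequently_def eventually_filtermap)
qed

lemma set_net_limit_reindex:
  assumes "directed_set I le" "directed_set J le'"
    and "filtermap b (net_filter J le') = filtermap a (net_filter I le)"
  shows "set_net_limit J le' (\<lambda>j. Y (b j)) K \<longleftrightarrow> set_net_limit I le (\<lambda>i. Y (a i)) K"
  unfolding set_net_limit_iff[OF assms(1)] set_net_limit_iff[OF assms(2)]
    frequently_reindex[OF assms(3), of "\<lambda>x. Y x \<inter> U \<noteq> {}" for U] ..

lemma filterlim_reindex:
  assumes "filtermap b G = filtermap a F"
  shows "filterlim (\<lambda>j. h (b j)) H G \<longleftrightarrow> filterlim (\<lambda>i. h (a i)) H F"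
proof -
  have "filtermap (\<lambda>j. h (b j)) G = filtermap (\<lambda>i. h (a i)) F"
    using arg_cong[OF assms, of "filtermap h"] by (simp add: filtermap_filtermap)
  then show ?thesis by (simp add: filterlim_def)
qed

lemma gamma_cone_any_index:
  fixes I :: "'i set" and \<Gamma> :: "'g::paratopological_group set"
  assumes dir: "directed_set I le" and g: "g \<in> I \<rightarrow> - {1}"
    and lim: "filterlim (\<lambda>i. gamma_length \<Gamma> (g i)) at_top (net_filter I le)"
    and C: "set_net_limit I le (\<lambda>i. gamma_K \<Gamma> (g i)) C"
  shows "gamma_cone \<Gamma> C"
proof -
  have "eventually (\<lambda>i. gamma_length \<Gamma> (g j) \<le> gamma_length \<Gamma> (g i)) (net_filter I le)" for j
    using lim by (simp add: filterlim_at_top)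
  from net_reindex[of I le "gamma_length \<Gamma>" g, OF dir this]
  obtain J :: "'g net_index set" and le' where J: "directed_set J le'" "fst \<in> J \<rightarrow> g ` I"
    "\<forall>p\<in>J. \<forall>q\<in>J. le' p q \<longrightarrow> gamma_length \<Gamma> (fst p) \<le> gamma_length \<Gamma> (fst q)"
    "filtermap fst (net_filter J le') = filtermap g (net_filter I le)" by blast
  have "fst \<in> J \<rightarrow> - {1}" using J(2) g by (fastforce simp: Pi_iff)
  moreover have "filterlim (\<lambda>p. gamma_length \<Gamma> (fst p)) at_top (net_filter J le')"
    using lim filterlim_reindex[OF J(4)] by blast
  moreover have "set_net_limit J le' (\<lambda>p. gamma_K \<Gamma> (fst p)) C"
    using C set_net_limit_reindex[OF dir J(1,4)] by blast
  ultimately show ?thesis unfolding gamma_cone_def using J(1,3) by blast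
qed

lemma gamma_recurrent_II_any_index:
  fixes I :: "'i set" and act :: "'g::paratopological_group \<Rightarrow> 'x \<Rightarrow> 'x::topological_space"
  assumes x: "gamma_recurrent_II act \<Gamma> x" and U: "x \<in> interior U"
    and dir: "directed_set I le" and g: "g \<in> I \<rightarrow> - {1}"
    and lim: "filterlim (\<lambda>i. gamma_length \<Gamma> (g i)) at_top (net_filter I le)"
  shows "\<exists>n\<ge>1. \<exists>(J :: 'i set) le' \<phi> c. subnet_map I le J le' \<phi> \<and>
    (\<forall>j\<in>J. c j \<in> gamma_K \<Gamma> (g (\<phi> j)) \<and> act (c j) x \<in> U \<and> gamma_length \<Gamma> (c j) \<le> n)"
proof -
  obtain J :: "'g net_index set" and le' where J: "directed_set J le'" "fst \<in> J \<rightarrow> g ` I"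
    "filtermap fst (net_filter J le') = filtermap g (net_filter I le)"
    using net_reindex[of I le "\<lambda>_. 0" g, OF dir] by auto
  have 1: "fst \<in> J \<rightarrow> - {1}" using J(2) g by (fastforce simp: Pi_iff)
  have 2: "filterlim (\<lambda>p. gamma_length \<Gamma> (fst p)) at_top (net_filter J le')"
    using lim filterlim_reindex[OF J(3)] by blast
  obtain n and L :: "'g net_index set" and le'' \<phi> c where n: "n \<ge> (1::nat)"
    and sub: "subnet_map J le' L le'' \<phi>"
    and c: "\<forall>j\<in>L. c j \<in> gamma_K \<Gamma> (fst (\<phi> j)) \<and> act (c j) x \<in> U \<and> gamma_length \<Gamma> (c j) \<le> n"
    using x[unfolded gamma_recurrent_II_def, rule_format, OF U J(1) 1 2] by blast
  define P where "P = (\<lambda>h. \<exists>c. c \<in> gamma_K \<Gamma> h \<and> act c x \<in> U \<and> gamma_length \<Gamma> c \<le> n)"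
  have dL: "directed_set L le''" using sub by (auto simp: subnet_map_def)
  have "eventually (\<lambda>j. P (fst (\<phi> j))) (net_filter L le'')"
    using c dL unfolding eventually_net_filter[OF dL] P_def directed_set_def by blast
  then have "\<exists>\<^sub>F p in net_filter J le'. P (fst p)"
    using subnet_imp_frequently[OF sub J(1), of "\<lambda>p. P (fst p)"] by blast
  then have "\<exists>\<^sub>F i in net_filter I le. P (g i)"
    using frequently_reindex[OF J(3), of P] by blast
  then have sub': "subnet_map I le {i \<in> I. P (g i)} le (\<lambda>i. i)"
    by (rule frequently_imp_subnet[OF dir])
  have "\<forall>i\<in>{i \<in> I. P (g i)}. \<exists>c. c \<in> gamma_K \<Gamma> (g i) \<and> act c x \<in> U \<and> gamma_length \<Gamma> c \<le> n"
    by (auto simp: P_def)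
  then obtain c' where "\<forall>i\<in>{i \<in> I. P (g i)}.
      c' i \<in> gamma_K \<Gamma> (g i) \<and> act (c' i) x \<in> U \<and> gamma_length \<Gamma> (c' i) \<le> n" by metis
  with sub' n show ?thesis by blast
qed

lemma gamma_recurrent_II_any_subnet_index:
  fixes I :: "'i set" and J :: "'j set"
  assumes dir: "directed_set I le" and sub: "subnet_map I le J le' \<phi>"
    and c: "\<forall>j\<in>J. c j \<in> gamma_K \<Gamma> (g (\<phi> j)) \<and> act (c j) x \<in> U \<and> gamma_length \<Gamma> (c j) \<le> n"
  shows "\<exists>(L :: 'i set) le'' \<psi> c'. subnet_map I le L le'' \<psi> \<and>
    (\<forall>j\<in>L. c' j \<in> gamma_K \<Gamma> (g (\<psi> j)) \<and> act (c' j) x \<in> U \<and> gamma_length \<Gamma> (c' j) \<le> n)"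
proof -
  define P where "P = (\<lambda>h. \<exists>c. c \<in> gamma_K \<Gamma> h \<and> act c x \<in> U \<and> gamma_length \<Gamma> c \<le> n)"
  have dJ: "directed_set J le'" using sub by (auto simp: subnet_map_def)
  have "eventually (\<lambda>j. P (g (\<phi> j))) (net_filter J le')"
    using c dJ unfolding eventually_net_filter[OF dJ] P_def directed_set_def by blast
  then have "\<exists>\<^sub>F i in net_filter I le. P (g i)"
    using subnet_imp_frequently[OF sub dir, of "\<lambda>i. P (g i)"] by blast
  then have sub': "subnet_map I le {i \<in> I. P (g i)} le (\<lambda>i. i)"
    by (rule frequently_imp_subnet[OF dir])
  have "\<forall>i\<in>{i \<in> I. P (g i)}. \<exists>c. c \<in> gamma_K \<Gamma> (g i) \<and> act c x \<in> U \<and> gamma_length \<Gamma> c \<le> n"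
    by (auto simp: P_def)
  then obtain c' where "\<forall>i\<in>{i \<in> I. P (g i)}.
      c' i \<in> gamma_K \<Gamma> (g i) \<and> act (c' i) x \<in> U \<and> gamma_length \<Gamma> (c' i) \<le> n" by metis
  with sub' show ?thesis by blast
qed

lemma orbit_closure_continuous_any_index:
  fixes I :: "'i set" and act :: "'g::paratopological_group \<Rightarrow> 'x \<Rightarrow> 'x::topological_space"
  assumes cont: "orbit_closure_continuous act" and dir: "directed_set I le"
    and lim: "(a \<longlongrightarrow> x) (net_filter I le)"
  shows "set_net_limit I le (\<lambda>i. orbit_closure act (a i)) (orbit_closure act x)"
proof -
  obtain J :: "'x net_index set" and le' where J: "directed_set J le'"
    "fst \<in> J \<rightarrow> a ` I" "filtermap fst (net_filter J le') = filtermap a (net_filter I le)"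
    using net_reindex[of I le "\<lambda>_. 0" a, OF dir] by auto
  have "(fst \<longlongrightarrow> x) (net_filter J le')"
    using lim filterlim_reindex[OF J(3), of "\<lambda>x. x"] by blast
  then have "set_net_limit J le' (\<lambda>p. orbit_closure act (fst p)) (orbit_closure act x)"
    using cont J(1) unfolding orbit_closure_continuous_def by blast
  then show ?thesis using set_net_limit_reindex[OF dir J(1,3)] by blast
qed

end

theory Submission
  imports Defs
begin

text \<open>
  The hub of all equivalences is the openness of the sets \<open>U\<^sup>*\<^sub>G\<close>.  If it fails at \<open>x\<close>, take
  points \<open>z\<close> near \<open>x\<close> whose orbits leave \<open>U\<close>, and a shortest \<open>g\<close> with \<open>g z \<notin> U\<close>.  By compactness
  of the powers of \<open>\<Gamma>\<close> the lengths of these \<open>g\<close> tend to infinity, the first exit points \<open>g z\<close>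
  lie in the compact set \<open>\<Gamma>U - U\<close> and cluster at some \<open>y \<notin> U\<close>, and minimality of \<open>g\<close> says that
  \<open>K(g\<^sup>-\<^sup>1)\<close> maps \<open>g z\<close> into \<open>U\<close>.  In the limit a cone (or a bounded net in the \<open>K(g\<^sup>-\<^sup>1)\<close>) moves
  \<open>y\<close> into \<open>U\<close>, so \<open>y\<close> is not recurrent.  Conversely, if orbit closures are minimal, then finitely
  many \<open>f\<close> bring every point of the orbit of \<open>x\<close> back near \<open>x\<close>; since \<open>K(h)\<close> contains a translate
  \<open>\<Gamma>\<^sup>n s\<close> with \<open>|s| \<le> n + 1\<close> as soon as \<open>|h| > n\<close>, both kinds of recurrence follow.
\<close>

text \<open>The algebra of inverses is inherited from \<open>group\<close>; continuity of inversion
  never enters.\<close>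

sublocale paratopological_group < pgroup: group "(*)" 1 inverse
  by standard (simp_all add: inverse_mult_self)

lemma (in paratopological_group) inverse_mult_cancel [simp]:
  "inverse a * (a * b) = b" "a * (inverse a * b) = b"
  by (simp_all add: mult.assoc [symmetric])


section \<open>Filters and nets\<close>

text \<open>The definitions speak of nets, the proofs below of filters. An index is a set of the
  filter with a point in it, and the order is reverse inclusion of the sets. Admitting only sets on
  which \<open>P\<close> holds makes \<open>P\<close> true at every index, as the condition
  \<open>g \<in> I \<rightarrow> - {1}\<close> on nets demands.\<close>

lemma filter_as_net:
  fixes F :: "'a filter"
  assumes "F \<noteq> bot" and P: "eventually P F"
  obtains J :: "'a net_index set" and le :: "'a \<times> 'a set \<Rightarrow> 'a \<times> 'a set \<Rightarrow> bool" where
    "directed_set J le" "\<And>p. p \<in> J \<Longrightarrow> P (fst p)" "filtermap fst (net_filter J le) = F"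
proof -
  define E where "E = (\<lambda>A. eventually (\<lambda>x. x \<in> A) F \<and> (\<forall>x\<in>A. P x))"
  define J where "J = {(x, A). E A \<and> x \<in> A}"
  define le where "le = (\<lambda>(p :: 'a \<times> 'a set) (q :: 'a \<times> 'a set). snd q \<subseteq> snd p)"
  have ne: "\<exists>x. x \<in> A" if "E A" for A
    using that \<open>F \<noteq> bot\<close> eventually_happens[of "\<lambda>x. x \<in> A" F] by (auto simp: E_def)
  have E0: "E {x. P x}" using P by (simp add: E_def)
  have Eint: "E (A \<inter> B)" if "E A" "E B" for A B
    using that by (auto simp: E_def eventually_conj)
  have dJ: "directed_set J le"
    unfolding directed_set_def
  proof (intro conjI ballI)
    show "J \<noteq> {}" using ne[OF E0] E0 by (auto simp: J_def)
    show "reflp_on J le" by (auto simp: reflp_on_def le_def)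
    show "transp_on J le" by (auto simp: transp_on_def le_def)
  next
    fix p q assume "p \<in> J" "q \<in> J"
    then have A: "E (snd p \<inter> snd q)" by (auto simp: J_def intro: Eint)
    then obtain x where "x \<in> snd p \<inter> snd q" using ne by blast
    then have "(x, snd p \<inter> snd q) \<in> J" using A by (simp add: J_def)
    then show "\<exists>r\<in>J. le p r \<and> le q r" by (rule bexI[rotated]) (auto simp: le_def)
  qed
  have "eventually Q (filtermap fst (net_filter J le)) \<longleftrightarrow> eventually Q F" for Q
  proof
    assume "eventually Q (filtermap fst (net_filter J le))"
    then obtain p where p: "p \<in> J" "\<forall>q\<in>J. le p q \<longrightarrow> Q (fst q)"
      unfolding eventually_filtermap eventually_net_filter[OF dJ] by blast
    have "Q x" if "x \<in> snd p" for x
      using p that by (auto simp: J_def le_def)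
    moreover have "eventually (\<lambda>x. x \<in> snd p) F" using p(1) by (auto simp: J_def E_def)
    ultimately show "eventually Q F" by (auto elim: eventually_mono)
  next
    assume "eventually Q F"
    then have A: "E {x. P x \<and> Q x}" using P by (auto simp: E_def eventually_conj)
    then obtain x where "x \<in> {x. P x \<and> Q x}" using ne by blast
    then have "(x, {x. P x \<and> Q x}) \<in> J" using A by (simp add: J_def)
    moreover have "\<forall>q\<in>J. le (x, {x. P x \<and> Q x}) q \<longrightarrow> Q (fst q)"
      by (auto simp: J_def le_def)
    ultimately show "eventually Q (filtermap fst (net_filter J le))"
      unfolding eventually_filtermap eventually_net_filter[OF dJ] by blast
  qed
  then have "filtermap fst (net_filter J le) = F" by (simp add: filter_eq_iff)
  moreover have "P (fst p)" if "p \<in> J" for p using that by (auto simp: J_def E_def)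
  ultimately show ?thesis using that dJ by blast
qed

lemma net_filter_neq_bot: "directed_set I le \<Longrightarrow> net_filter I le \<noteq> bot"
  using eventually_net_filter[of I le "\<lambda>_. False"]
  by (auto simp: trivial_limit_def directed_set_def reflp_on_def)

lemma eventually_in_net_filter: "directed_set I le \<Longrightarrow> \<forall>\<^sub>F i in net_filter I le. i \<in> I"
  by (auto simp: eventually_net_filter directed_set_def)

text \<open>The finer filter in the conclusion replaces passing to a subnet: what holds eventually
  along \<open>F\<close> persists, and \<open>f\<close> tends to \<open>y\<close> along it.\<close>

lemma compact_cluster_point:
  assumes "compact K" and "F \<noteq> bot" and "\<forall>\<^sub>F i in F. f i \<in> K"
  obtains y where "y \<in> K" "inf F (filtercomap f (nhds y)) \<noteq> bot"
proof -
  have "filtermap f F \<noteq> bot" "eventually (\<lambda>x. x \<in> K) (filtermap f F)"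
    using assms by (auto simp: filtermap_bot_iff eventually_filtermap)
  then obtain y where y: "y \<in> K" "inf (nhds y) (filtermap f F) \<noteq> bot"
    using \<open>compact K\<close> unfolding compact_filter by blast
  have "inf F (filtercomap f (nhds y)) \<noteq> bot"
  proof
    assume "inf F (filtercomap f (nhds y)) = bot"
    then have "eventually (\<lambda>_. False) (inf F (filtercomap f (nhds y)))" by simp
    then obtain P Q where PQ: "eventually P F" "eventually Q (filtercomap f (nhds y))"
      "\<And>i. P i \<Longrightarrow> Q i \<Longrightarrow> False"
      unfolding eventually_inf by blast
    obtain R where R: "eventually R (nhds y)" "\<And>i. R (f i) \<Longrightarrow> Q i"
      using PQ(2) unfolding eventually_filtercomap by blast
    have "eventually (\<lambda>z. \<not> R z) (filtermap f F)"
      unfolding eventually_filtermap using PQ(1) by (rule eventually_mono) (use PQ(3) R(2) in blast)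
    with R(1) have "eventually (\<lambda>_. False) (inf (nhds y) (filtermap f F))"
      unfolding eventually_inf by blast
    with y(2) show False by (simp add: trivial_limit_def)
  qed
  with y(1) show ?thesis by (rule that)
qed


section \<open>Word length\<close>

lemma compact_set_times:
  fixes A B :: "'a::topological_semigroup_mult set"
  assumes "compact A" "compact B"
  shows "compact (A * B)"
  unfolding set_times_image split_def
  by (intro compact_continuous_image compact_Times assms continuous_intros)

locale compactly_generated =
  fixes \<Gamma> :: "'g::paratopological_group set"
  assumes generated: "compactly_generated_by \<Gamma>"
begin

abbreviation len :: "'g \<Rightarrow> nat" where "len \<equiv> gamma_length \<Gamma>"

section \<open>Powers of the generating set as balls for the word length\<close>

lemma compact_generator: "compact \<Gamma>"
  and one_mem: "1 \<in> \<Gamma>"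
  and inverse_image_eq: "inverse ` \<Gamma> = \<Gamma>"
  using generated by (auto simp: compactly_generated_by_def)

lemma compact_power: "compact (\<Gamma> ^ n)"
proof (induction n)
  case 0
  then show ?case by (simp add: set_one)
next
  case (Suc n)
  then show ?case
    by (simp add: compact_generator compact_set_times)
qed

lemma power_mono: "m \<le> n \<Longrightarrow> \<Gamma> ^ m \<subseteq> \<Gamma> ^ n"
proof (induction rule: dec_induct)
  case (step n)
  have "\<Gamma> ^ n \<subseteq> \<Gamma> ^ Suc n"
    using set_times_intro[OF one_mem] by fastforce
  with step show ?case by blast
qed simp

lemma inverse_mem_power: "g \<in> \<Gamma> ^ n \<Longrightarrow> inverse g \<in> \<Gamma> ^ n"
proof (induction n arbitrary: g)
  case 0
  then show ?case by (simp add: set_one)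
next
  case (Suc n)
  then obtain a b where ab: "g = a * b" "a \<in> \<Gamma>" "b \<in> \<Gamma> ^ n"
    by (auto elim: set_times_elim)
  then have "inverse g = inverse b * inverse a"
    by (simp add: pgroup.inverse_distrib_swap)
  moreover have "inverse b \<in> \<Gamma> ^ n" "inverse a \<in> \<Gamma>"
    using ab Suc.IH inverse_image_eq by blast+
  ultimately show ?case by (auto simp: power_Suc2 simp del: power_Suc)
qed

lemma mem_power_len: "g \<in> \<Gamma> ^ len g"
proof -
  have "g \<in> (\<Union>r\<in>{1..}. \<Gamma> ^ r)" using generated by (simp add: compactly_generated_by_def)
  then obtain r where "g \<in> \<Gamma> ^ r" by blast
  then show ?thesis unfolding gamma_length_def by (rule LeastI)
qed

lemma len_le_iff: "len g \<le> n \<longleftrightarrow> g \<in> \<Gamma> ^ n"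
  using mem_power_len power_mono by (auto simp: gamma_length_def intro: Least_le)

lemma len_inverse: "len (inverse g) = len g"
  by (metis inverse_mem_power len_le_iff mem_power_len order_antisym pgroup.inverse_inverse)

lemma len_one: "len 1 = 0"
  using len_le_iff[of 1 0] by (simp add: set_one)

lemma finite_subset_power:
  assumes "finite F"
  obtains n where "n \<ge> 1" "F \<subseteq> \<Gamma> ^ n"
proof
  \<comment> \<open>The sum bounds every single length, and \<open>Suc\<close> secures
    \<open>n \<ge> 1\<close>.\<close>
  show "F \<subseteq> \<Gamma> ^ Suc (\<Sum>f\<in>F. len f)"
    using assms
    by (auto simp: len_le_iff[symmetric] simp del: power_Suc intro!: le_SucI member_le_sum)
qed simp

text \<open>For the right-invariant distance \<open>len (c * inverse d)\<close> this is the ball of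
  radius \<open>len h - 1\<close> about \<open>h\<close>; if \<open>h \<noteq> 1\<close>, the unit
  lies just outside.\<close>

lemma mem_gamma_K_iff: "c \<in> gamma_K \<Gamma> h \<longleftrightarrow> len (c * inverse h) \<le> len h - 1"
proof
  assume "c \<in> gamma_K \<Gamma> h"
  then obtain w where "c = w * h" "w \<in> \<Gamma> ^ (len h - 1)"
    by (auto simp: gamma_K_def elim: set_times_elim)
  then show "len (c * inverse h) \<le> len h - 1" by (simp add: len_le_iff mult.assoc)
next
  assume "len (c * inverse h) \<le> len h - 1"
  then have "(c * inverse h) * h \<in> gamma_K \<Gamma> h"
    unfolding gamma_K_def len_le_iff by blast
  then show "c \<in> gamma_K \<Gamma> h" by (simp add: mult.assoc)
qed

text \<open>A suffix \<open>s\<close> of length \<open>n + 1\<close> of a geodesic word for \<open>h\<close> gives the translate \<open>\<Gamma>\<^sup>n s\<close>.\<close>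

lemma gamma_K_contains_translate:
  assumes "n < len h"
  obtains s where "s \<in> \<Gamma> ^ Suc n" "\<And>f. f \<in> \<Gamma> ^ n \<Longrightarrow> f * s \<in> gamma_K \<Gamma> h"
proof -
  have "\<Gamma> ^ len h = \<Gamma> ^ (len h - Suc n) * \<Gamma> ^ Suc n"
    using assms by (simp only: power_add[symmetric]) simp
  then obtain w s where ws: "h = w * s" "w \<in> \<Gamma> ^ (len h - Suc n)" "s \<in> \<Gamma> ^ Suc n"
    using mem_power_len[of h] by (auto elim: set_times_elim)
  \<comment> \<open>The bounds \<open>n\<close> for \<open>f\<close> and
    \<open>len h - Suc n\<close> for \<open>inverse w\<close> add up to exactly the exponent in
    \<open>gamma_K\<close>.\<close>
  have eq: "\<Gamma> ^ (len h - 1) = \<Gamma> ^ n * \<Gamma> ^ (len h - Suc n)"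
    using assms by (simp only: power_add[symmetric]) simp
  have "f * s \<in> gamma_K \<Gamma> h" if "f \<in> \<Gamma> ^ n" for f
  proof -
    have "f * s * inverse h = f * inverse w"
      using ws(1) by (simp add: pgroup.inverse_distrib_swap mult.assoc)
    also have "\<dots> \<in> \<Gamma> ^ (len h - 1)"
      unfolding eq using that ws(2) inverse_mem_power by blast
    finally show ?thesis by (simp add: mem_gamma_K_iff len_le_iff)
  qed
  with ws(3) show ?thesis by (rule that)
qed

section \<open>Cones and type II recurrence along filters\<close>

lemma eventually_neq_one:
  assumes "filterlim (\<lambda>i. len (h i)) at_top F"
  shows "\<forall>\<^sub>F i in F. h i \<in> - {1}"
proof -
  have "\<forall>\<^sub>F i in F. 1 \<le> len (h i)" using assms by (simp add: filterlim_at_top)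
  then show ?thesis by (rule eventually_mono) (auto simp: len_one)
qed

text \<open>By \<open>set_net_limit_iff\<close> the set is a net limit; the monotone lengths that
  \<open>gamma_cone\<close> asks for are supplied by the reindexing in
  \<open>gamma_cone_any_index\<close>.\<close>

lemma gamma_cone_filter:
  fixes F :: "'i filter"
  assumes "F \<noteq> bot" and lim: "filterlim (\<lambda>i. len (h i)) at_top F"
  shows "gamma_cone \<Gamma> {c. \<forall>W. open W \<longrightarrow> c \<in> W \<longrightarrow> (\<exists>\<^sub>F i in F. gamma_K \<Gamma> (h i) \<inter> W \<noteq> {})}"
    (is "gamma_cone \<Gamma> ?C")
proof -
  obtain J :: "'i net_index set" and le where J: "directed_set J le"
    "\<And>p. p \<in> J \<Longrightarrow> h (fst p) \<in> - {1}" "filtermap fst (net_filter J le) = F"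
    using filter_as_net[OF \<open>F \<noteq> bot\<close> eventually_neq_one[OF lim]] by metis
  show ?thesis
  proof (rule gamma_cone_any_index[OF J(1), of "\<lambda>p. h (fst p)"])
    show "filterlim (\<lambda>p. len (h (fst p))) at_top (net_filter J le)"
      using lim unfolding J(3)[symmetric] by (simp add: filterlim_filtermap)
    show "set_net_limit J le (\<lambda>p. gamma_K \<Gamma> (h (fst p))) ?C"
      unfolding set_net_limit_iff[OF J(1)] J(3)[symmetric] frequently_def eventually_filtermap ..
  qed (use J(2) in auto)
qed

text \<open>Holding along a subnet becomes holding frequently; the bound \<open>n\<close> remains
  uniform over the indices.\<close>

lemma gamma_recurrent_II_filter:
  fixes F :: "'i filter"
  assumes "gamma_recurrent_II act \<Gamma> x" and U: "x \<in> interior U"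
    and "F \<noteq> bot" and lim: "filterlim (\<lambda>i. len (h i)) at_top F"
  obtains n where
    "\<exists>\<^sub>F i in F. \<exists>c. c \<in> gamma_K \<Gamma> (h i) \<and> act c x \<in> U \<and> c \<in> \<Gamma> ^ n"
proof -
  obtain J :: "'i net_index set" and le where J: "directed_set J le"
    "\<And>p. p \<in> J \<Longrightarrow> h (fst p) \<in> - {1}" "filtermap fst (net_filter J le) = F"
    using filter_as_net[OF \<open>F \<noteq> bot\<close> eventually_neq_one[OF lim]] by metis
  have "filterlim (\<lambda>p. len (h (fst p))) at_top (net_filter J le)"
    using lim unfolding J(3)[symmetric] by (simp add: filterlim_filtermap)
  moreover have "(\<lambda>p. h (fst p)) \<in> J \<rightarrow> - {1}" using J(2) by auto
  ultimately obtain n and L :: "'i net_index set" and le' \<phi> c where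
    sub: "subnet_map J le L le' \<phi>" and
    c: "\<forall>j\<in>L. c j \<in> gamma_K \<Gamma> (h (fst (\<phi> j))) \<and> act (c j) x \<in> U \<and> len (c j) \<le> n"
    using gamma_recurrent_II_any_index[OF assms(1) U J(1), of "\<lambda>p. h (fst p)"] by blast
  define Q where "Q = (\<lambda>i. \<exists>c. c \<in> gamma_K \<Gamma> (h i) \<and> act c x \<in> U \<and> c \<in> \<Gamma> ^ n)"
  have "directed_set L le'" using sub by (simp add: subnet_map_def)
  then have "\<forall>\<^sub>F j in net_filter L le'. Q (fst (\<phi> j))"
    using c by (auto simp: Q_def len_le_iff intro: eventually_mono[OF eventually_in_net_filter])
  then have "\<exists>\<^sub>F p in net_filter J le. Q (fst p)"
    using subnet_imp_frequently[OF sub J(1), of "\<lambda>p. Q (fst p)"] by blast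
  then have "\<exists>\<^sub>F i in F. Q i"
    unfolding J(3)[symmetric] frequently_def eventually_filtermap .
  then show ?thesis using that unfolding Q_def by blast
qed

end


section \<open>Orbit closures\<close>

locale continuous_flow =
  fixes act :: "'g::paratopological_group \<Rightarrow> 'x \<Rightarrow> 'x::{uniform_space,t2_space}"
  assumes flow: "flow act"
begin

abbreviation oc :: "'x \<Rightarrow> 'x set" where "oc \<equiv> orbit_closure act"

section \<open>Continuity of the action and invariance of orbit closures\<close>

lemma act_one [simp]: "act 1 x = x"
  and act_mult: "act (s * t) x = act s (act t x)"
  and compact_oc: "compact (oc x)"
  and continuous_act: "continuous_on UNIV (\<lambda>(t, x). act t x)"
  using flow by (auto simp: flow_def)

lemma act_inverse [simp]: "act (inverse t) (act t x) = x" "act t (act (inverse t) x) = x"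
  by (simp_all flip: act_mult)

lemma open_act_preimage: "open V \<Longrightarrow> open {p. act (fst p) (snd p) \<in> V}"
  using continuous_act by (simp add: continuous_on_open_vimage vimage_def split_def)

lemma open_vimage_act: "open V \<Longrightarrow> open {x. act t x \<in> V}"
  using open_vimage[OF open_act_preimage, of V "\<lambda>x. (t, x)"]
  by (simp add: vimage_def continuous_intros)

lemma closed_vimage_act: "closed V \<Longrightarrow> closed {x. act t x \<in> V}"
  using open_vimage_act[of "- V" t] by (simp add: closed_def Collect_neg_eq)

text \<open>Joint continuity makes the set of good pairs open, and the tube lemma fits a
  neighbourhood of \<open>x\<close> times \<open>Q\<close> into it.\<close>

lemma eventually_act_compact:
  assumes "compact Q" "open V" "\<And>c. c \<in> Q \<Longrightarrow> act c x \<in> V"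
  shows "\<forall>\<^sub>F z in nhds x. \<forall>c\<in>Q. act c z \<in> V"
proof -
  have "open {p. act (snd p) (fst p) \<in> V}"
    using open_vimage[OF open_act_preimage[OF assms(2)], of prod.swap]
    by (simp add: vimage_def continuous_intros prod.swap_def)
  moreover have "{x} \<times> Q \<subseteq> {p. act (snd p) (fst p) \<in> V}" using assms(3) by auto
  ultimately obtain X where "x \<in> X" "open X" "X \<times> Q \<subseteq> {p. act (snd p) (fst p) \<in> V}"
    using Elementary_Topology.tube_lemma[OF assms(1), of "{p. act (snd p) (fst p) \<in> V}" x] by blast
  then show ?thesis unfolding eventually_nhds by (intro exI[of _ X]) auto
qed

lemma act_in_oc: "act t x \<in> oc x"
  unfolding orbit_closure_def by (meson closure_subset rangeI subsetD)

lemma self_in_oc: "x \<in> oc x"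
  using act_in_oc[of 1 x] by simp

lemma closed_oc: "closed (oc x)"
  by (simp add: orbit_closure_def)

lemma oc_subset_iff: "closed U \<Longrightarrow> oc x \<subseteq> U \<longleftrightarrow> (\<forall>t. act t x \<in> U)"
  using closure_minimal[of "range (\<lambda>t. act t x)" U] act_in_oc
  by (auto simp: orbit_closure_def)

lemma act_oc: "y \<in> oc x \<Longrightarrow> act t y \<in> oc x"
proof -
  have "oc x \<subseteq> {y. act t y \<in> oc x}"
    using closed_vimage_act[OF closed_oc] act_in_oc
    by (simp add: oc_subset_iff flip: act_mult)
  then show "y \<in> oc x \<Longrightarrow> act t y \<in> oc x" by blast
qed

lemma oc_mono: "y \<in> oc x \<Longrightarrow> oc y \<subseteq> oc x"
  by (simp add: oc_subset_iff[OF closed_oc] act_oc)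

lemma oc_act: "oc (act t x) = oc x"
  using oc_mono[OF act_in_oc] oc_mono[OF act_in_oc[of "inverse t" "act t x"]] by auto

lemma oc_meets_open: "y \<in> oc x \<Longrightarrow> open V \<Longrightarrow> y \<in> V \<Longrightarrow> \<exists>t. act t x \<in> V"
  unfolding orbit_closure_def closure_iff_nhds_not_empty by blast

section \<open>Symmetry of the orbit closure relation\<close>

definition symmetric_orbits :: bool where
  "symmetric_orbits \<longleftrightarrow> (\<forall>x y. y \<in> oc x \<longrightarrow> x \<in> oc y)"

text \<open>Membership in orbit closures is reflexive and transitive by \<open>self_in_oc\<close>
  and \<open>oc_mono\<close>. Symmetry makes it an equivalence relation whose classes are the orbit
  closures, and these are then minimal.\<close>

lemma union_of_minimal_sets_iff:
  "(\<exists>M. (\<forall>K\<in>M. minimal_set act K) \<and> \<Union>M = UNIV) \<longleftrightarrow> symmetric_orbits"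
proof
  assume "\<exists>M. (\<forall>K\<in>M. minimal_set act K) \<and> \<Union>M = UNIV"
  then obtain M where M: "\<forall>K\<in>M. minimal_set act K" "\<Union>M = UNIV"
    by (elim exE conjE)
  show symmetric_orbits
    unfolding symmetric_orbits_def
  proof (intro allI impI)
    fix x y assume y: "y \<in> oc x"
    obtain K where K: "K \<in> M" "x \<in> K" using UNIV_I[of x] unfolding M(2)[symmetric] by (rule UnionE)
    then have "oc x = K" "oc y = K"
      using M(1) K y by (auto simp: minimal_set_def)
    then show "x \<in> oc y" using K by simp
  qed
next
  assume symmetric_orbits
  then have "oc y = oc x" if "y \<in> oc x" for x y
    using that oc_mono[of y x] oc_mono[of x y] by (auto simp: symmetric_orbits_def)
  then have "minimal_set act (oc x)" for x
    by (simp add: minimal_set_def)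
  then show "\<exists>M. (\<forall>K\<in>M. minimal_set act K) \<and> \<Union>M = UNIV"
    using self_in_oc by (intro exI[of _ "range oc"]) auto
qed

text \<open>By symmetry every point of \<open>oc x\<close> has \<open>x\<close> in its orbit
  closure, so some time moves it into \<open>V\<close>. The preimages of \<open>V\<close> under the
  time maps thus cover the compact set \<open>oc x\<close>.\<close>

lemma symmetric_orbits_cover:
  assumes symmetric_orbits and "open V" "x \<in> V"
  obtains F where "finite F" "oc x \<subseteq> {z. \<exists>f\<in>F. act f z \<in> V}"
proof -
  have "\<exists>t. act t z \<in> V" if "z \<in> oc x" for z
    using assms that oc_meets_open unfolding symmetric_orbits_def by blast
  then have "oc x \<subseteq> (\<Union>t\<in>UNIV. {z. act t z \<in> V})" by blast
  then obtain F where "F \<subseteq> UNIV" "finite F" "oc x \<subseteq> (\<Union>t\<in>F. {z. act t z \<in> V})"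
    using compactE_image[OF compact_oc[of x], of UNIV "\<lambda>t. {z. act t z \<in> V}"]
      open_vimage_act[OF \<open>open V\<close>] by blast
  then show ?thesis by (intro that[of F]) auto
qed

lemma symmetric_orbits_imp_almost_periodic:
  assumes symmetric_orbits
  shows "almost_periodic act x"
  unfolding almost_periodic_def
proof (intro allI impI)
  fix U assume "x \<in> interior U"
  then obtain F where F: "finite F" "oc x \<subseteq> {z. \<exists>f\<in>F. act f z \<in> interior U}"
    using symmetric_orbits_cover[OF assms open_interior] by blast
  have "g \<in> inverse ` F * {t. act t x \<in> U}" for g
  proof -
    obtain f where f: "f \<in> F" "act f (act g x) \<in> U"
      using F(2) act_in_oc[of g x] interior_subset by blast
    \<comment> \<open>This product is \<open>g\<close> itself, written with the return time
      \<open>f * g\<close>.\<close>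
    then have "inverse f * (f * g) \<in> inverse ` F * {t. act t x \<in> U}"
      by (intro set_times_intro) (auto simp: act_mult)
    then show ?thesis by simp
  qed
  then show "syndetic {t. act t x \<in> U}"
    unfolding syndetic_def using finite_imp_compact[OF F(1)] by blast
qed

lemma syndeticE:
  assumes "syndetic {t. act t x \<in> U}"
  obtains K where "compact K" "\<And>t. \<exists>k\<in>K. act k (act t x) \<in> U"
proof -
  obtain K where K: "compact K" "inverse ` K * {t. act t x \<in> U} = UNIV"
    using assms by (auto simp: syndetic_def)
  have "\<exists>k\<in>K. act k (act t x) \<in> U" for t
  proof -
    have "t \<in> inverse ` K * {t. act t x \<in> U}" using K(2) by simp
    then obtain k a where ka: "t = inverse k * a" "k \<in> K" "act a x \<in> U"
      by (auto elim: set_times_elim)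
    then have "act k (act t x) = act a x" by (simp flip: act_mult)
    with ka show ?thesis by metis
  qed
  with K(1) show ?thesis by (rule that)
qed

text \<open>The section \<open>{z. x \<in> oc z}\<close> is closed and contains the orbit of
  \<open>x\<close>, because \<open>oc\<close> is constant on orbits; hence it contains
  \<open>oc x\<close>.\<close>

lemma closed_relation_imp_symmetric_orbits:
  assumes "closed {(x, y). y \<in> oc x}"
  shows symmetric_orbits
  unfolding symmetric_orbits_def
proof (intro allI impI)
  fix x y assume y: "y \<in> oc x"
  have "closed {z. x \<in> oc z}"
    using closed_vimage[OF assms, of "\<lambda>z. (z, x)"] by (simp add: vimage_def continuous_intros)
  then have "oc x \<subseteq> {z. x \<in> oc z}"
    using oc_act self_in_oc by (simp add: oc_subset_iff)
  with y show "x \<in> oc y" by blast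
qed

text \<open>Along a net in the orbit of \<open>x\<close> tending to \<open>y\<close>, the orbit
  closures are constantly \<open>oc x\<close>. Continuity makes their limit \<open>oc y\<close>,
  which therefore contains \<open>x\<close>.\<close>

lemma orbit_closure_continuous_imp_symmetric_orbits:
  assumes "orbit_closure_continuous act"
  shows symmetric_orbits
  unfolding symmetric_orbits_def
proof (intro allI impI)
  fix x y assume y: "y \<in> oc x"
  have "inf (nhds y) (principal (range (\<lambda>t. act t x))) \<noteq> bot"
    using oc_meets_open[OF y]
    by (fastforce simp: trivial_limit_def eventually_inf_principal eventually_nhds)
  then obtain J :: "'x net_index set" and le where J: "directed_set J le"
    "\<And>p. p \<in> J \<Longrightarrow> fst p \<in> range (\<lambda>t. act t x)"
    "filtermap fst (net_filter J le) = inf (nhds y) (principal (range (\<lambda>t. act t x)))"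
    by (rule filter_as_net[where P = "\<lambda>z. z \<in> range (\<lambda>t. act t x)"])
       (auto simp: eventually_inf_principal)
  have "(fst \<longlongrightarrow> y) (net_filter J le)" by (simp add: filterlim_def J(3))
  then have "set_net_limit J le (\<lambda>p. oc (fst p)) (oc y)"
    using assms J(1) unfolding orbit_closure_continuous_def by blast
  moreover have "oc (fst p) = oc x" if "p \<in> J" for p
    using J(2)[OF that] oc_act by auto
  then have "\<exists>\<^sub>F p in net_filter J le. oc (fst p) \<inter> U \<noteq> {}" if "x \<in> U" for U
    using that self_in_oc[of x] J(1)
    by (intro eventually_frequently net_filter_neq_bot
          eventually_mono[OF eventually_in_net_filter[OF J(1)]]) auto
  ultimately show "x \<in> oc y"
    unfolding set_net_limit_iff[OF J(1)] by blast
qed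

end


section \<open>Zero-dimensional phase spaces\<close>

locale zero_dimensional_flow = continuous_flow act
  for act :: "'g::paratopological_group \<Rightarrow> 'x \<Rightarrow> 'x::{uniform_space,t2_space}" +
  assumes zero_dim: "zero_dimensional TYPE('x)"
begin

section \<open>Compact open neighbourhoods\<close>

lemma clopen_neighbourhood:
  fixes x :: 'x
  assumes "open V" "x \<in> V"
  obtains W where "open W" "compact W" "x \<in> W" "W \<subseteq> V"
proof -
  obtain O' C where O': "open O'" "compact C" "x \<in> O'" "O' \<subseteq> C"
    using flow unfolding flow_def locally_compact_space_def by (simp; blast)
  obtain B :: "'x set set" where B: "topological_basis B" "\<forall>U\<in>B. open U \<and> closed U"
    using zero_dim by (auto simp: zero_dimensional_def)
  obtain W where W: "W \<in> B" "x \<in> W" "W \<subseteq> O' \<inter> V"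
    using topological_basisE[OF B(1), of "O' \<inter> V" x] O' assms by auto
  \<comment> \<open>The basic set \<open>W\<close> is closed and lies inside the compact set
    \<open>C\<close>.\<close>
  have "compact (C \<inter> W)" using O' B(2) W(1) by (intro compact_Int_closed) auto
  moreover have "C \<inter> W = W" using W O' by blast
  ultimately show ?thesis using that[of W] W B(2) by auto
qed

lemma clopen_between:
  fixes K :: "'x set"
  assumes "compact K" "open V" "K \<subseteq> V"
  obtains W where "open W" "compact W" "K \<subseteq> W" "W \<subseteq> V"
proof -
  have "\<exists>W. open W \<and> compact W \<and> x \<in> W \<and> W \<subseteq> V" if "x \<in> K" for x
    by (rule clopen_neighbourhood[OF \<open>open V\<close> subsetD[OF assms(3) that]]) blast
  then obtain W where W: "\<And>x. x \<in> K \<Longrightarrow> open (W x) \<and> compact (W x) \<and> x \<in> W x \<and> W x \<subseteq> V"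
    by metis
  obtain D where D: "D \<subseteq> K" "finite D" "K \<subseteq> (\<Union>x\<in>D. W x)"
    using compactE_image[OF \<open>compact K\<close>, of K W] W by blast
  show ?thesis
    by (rule that[of "\<Union>x\<in>D. W x"]) (use D W in \<open>auto intro!: compact_UN\<close>)
qed

section \<open>Stability of orbit closures and its reformulations\<close>

definition stable :: bool where
  "stable \<longleftrightarrow> (\<forall>U. compact U \<and> open U \<longrightarrow> open {x. oc x \<subseteq> U})"

text \<open>Compactness is automatic: the set is \<open>U\<close> intersected with closed preimages
  of \<open>U\<close>. The content of the condition is openness.\<close>

lemma stable_iff:
  "stable \<longleftrightarrow> (\<forall>U. compact U \<and> open U \<longrightarrow> compact {x. oc x \<subseteq> U} \<and> open {x. oc x \<subseteq> U})"
proof -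
  have "compact {x. oc x \<subseteq> U}" if "compact U" for U
  proof -
    have "{x. oc x \<subseteq> U} = U \<inter> (\<Inter>t. {x. act t x \<in> U})"
      using oc_subset_iff[OF compact_imp_closed[OF that]] self_in_oc by blast
    then show ?thesis
      using that
      by (simp add: compact_Int_closed closed_INT closed_vimage_act compact_imp_closed)
  qed
  then show ?thesis by (auto simp: stable_def)
qed

text \<open>A compact open set between the compact \<open>oc x\<close> and \<open>V\<close> reduces
  arbitrary open sets to those in \<open>stable\<close>.\<close>

lemma stable_neighbourhood:
  assumes stable "open V" "oc x \<subseteq> V"
  obtains N where "open N" "x \<in> N" "\<And>y. y \<in> N \<Longrightarrow> oc y \<subseteq> V"
proof -
  obtain W where W: "open W" "compact W" "oc x \<subseteq> W" "W \<subseteq> V"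
    using clopen_between[OF compact_oc assms(2,3)] by blast
  then show ?thesis
    using that[of "{x. oc x \<subseteq> W}"] \<open>stable\<close> by (auto simp: stable_def)
qed

lemma stable_iff_usc: "stable \<longleftrightarrow> orbit_closure_usc act"
proof
  assume stable
  show "orbit_closure_usc act"
    unfolding orbit_closure_usc_def
  proof (intro allI impI)
    fix x U assume "oc x \<subseteq> interior U"
    then obtain N where "open N" "x \<in> N" "\<And>y. y \<in> N \<Longrightarrow> oc y \<subseteq> interior U"
      by (rule stable_neighbourhood[OF \<open>stable\<close> open_interior]) blast
    then show "\<exists>V. x \<in> interior V \<and> (\<forall>y\<in>V. oc y \<subseteq> U)"
      using interior_subset by (intro exI[of _ N]) (auto simp: interior_open)
  qed
next
  assume usc: "orbit_closure_usc act"
  show stable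
    unfolding stable_def
  proof (intro allI impI)
    fix U :: "'x set" assume U: "compact U \<and> open U"
    show "open {x. oc x \<subseteq> U}"
    proof (subst open_subopen, rule ballI)
      fix x assume "x \<in> {x. oc x \<subseteq> U}"
      then have "oc x \<subseteq> interior U" using U by (simp add: interior_open)
      then obtain V where "x \<in> interior V" "\<forall>y\<in>V. oc y \<subseteq> U"
        using usc unfolding orbit_closure_usc_def by blast
      then show "\<exists>T. open T \<and> x \<in> T \<and> T \<subseteq> {x. oc x \<subseteq> U}"
        using interior_subset by (intro exI[of _ "interior V"]) auto
    qed
  qed
qed

text \<open>If \<open>y \<notin> oc x\<close>, a compact open \<open>W\<close> around
  \<open>oc x\<close> misses \<open>y\<close>. Orbit closures of points near \<open>x\<close> stay
  in \<open>W\<close>, and \<open>- W\<close> is a neighbourhood of \<open>y\<close>.\<close>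

lemma stable_imp_closed_relation:
  assumes stable
  shows "closed {(x, y). y \<in> oc x}"
  unfolding closed_def
proof (rule open_prod_intro)
  fix p assume "p \<in> - {(x, y). y \<in> oc x}"
  then obtain x y where p: "p = (x, y)" "y \<notin> oc x" by (cases p) auto
  then obtain W where W: "open W" "compact W" "oc x \<subseteq> W" "W \<subseteq> - {y}"
    using clopen_between[OF compact_oc, of "- {y}" x] by auto
  obtain N where N: "open N" "x \<in> N" "\<And>z. z \<in> N \<Longrightarrow> oc z \<subseteq> W"
    by (rule stable_neighbourhood[OF assms W(1,3)]) blast
  have "open (- W)" using W(2) by (simp add: compact_imp_closed open_Compl)
  moreover have "p \<in> N \<times> (- W)" using p(1) N(2) W(4) by blast
  moreover have "N \<times> (- W) \<subseteq> - {(x, y). y \<in> oc x}" using N(3) by blast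
  ultimately show "\<exists>A B. open A \<and> open B \<and> p \<in> A \<times> B \<and> A \<times> B \<subseteq> - {(x, y). y \<in> oc x}"
    using N(1) by (intro exI[of _ N] exI[of _ "- W"] conjI)
qed

text \<open>Points of \<open>oc x\<close> are limits because the time maps are continuous; other
  points are excluded because the orbit closure relation is closed.\<close>

lemma stable_imp_orbit_closure_continuous:
  assumes stable
  shows "orbit_closure_continuous act"
  unfolding orbit_closure_continuous_def
proof (intro allI impI)
  fix I :: "'x net_index set" and le and a :: "'x net_index \<Rightarrow> 'x" and x :: 'x
  assume dir: "directed_set I le" and a: "(a \<longlongrightarrow> x) (net_filter I le)"
  have "y \<in> oc x \<longleftrightarrow> (\<forall>U. open U \<longrightarrow> y \<in> U \<longrightarrow> (\<exists>\<^sub>F i in net_filter I le. oc (a i) \<inter> U \<noteq> {}))"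
    (is "_ \<longleftrightarrow> ?R") for y
  proof
    assume y: "y \<in> oc x"
    show ?R
    proof (intro allI impI)
      fix U assume U: "open U" "y \<in> U"
      obtain t where t: "act t x \<in> U" using oc_meets_open[OF y U] by blast
      have "\<forall>\<^sub>F i in net_filter I le. a i \<in> {z. act t z \<in> U}"
        using a t by (intro topological_tendstoD open_vimage_act U) auto
      then have "\<forall>\<^sub>F i in net_filter I le. oc (a i) \<inter> U \<noteq> {}"
        by (rule eventually_mono) (use act_in_oc in blast)
      then show "\<exists>\<^sub>F i in net_filter I le. oc (a i) \<inter> U \<noteq> {}"
        by (intro eventually_frequently net_filter_neq_bot dir)
    qed
  next
    assume R: ?R
    show "y \<in> oc x"
    proof (rule ccontr)
      assume "y \<notin> oc x"
      then have "(x, y) \<in> - {(x, y). y \<in> oc x}" by simp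
      then obtain A B where AB0: "open A" "open B" "(x, y) \<in> A \<times> B"
        "A \<times> B \<subseteq> - {(x, y). y \<in> oc x}"
        by (rule open_prod_elim[OF stable_imp_closed_relation[OF assms, unfolded closed_def]])
      then have AB: "open A" "open B" "x \<in> A" "y \<in> B" "\<And>z. z \<in> A \<Longrightarrow> oc z \<inter> B = {}"
        by auto
      have "\<forall>\<^sub>F i in net_filter I le. a i \<in> A" using a AB by (intro topological_tendstoD)
      then have "\<forall>\<^sub>F i in net_filter I le. \<not> oc (a i) \<inter> B \<noteq> {}"
        by (rule eventually_mono) (use AB(5) in blast)
      then show False using R AB by (auto simp: frequently_def)
    qed
  qed
  then show "set_net_limit I le (\<lambda>i. oc (a i)) (oc x)"
    unfolding set_net_limit_iff[OF dir] by blast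
qed

section \<open>Pointwise and locally weak almost periodicity\<close>

lemma almost_periodic_imp_symmetric_orbits:
  assumes "\<And>x. almost_periodic act x"
  shows symmetric_orbits
  unfolding symmetric_orbits_def
proof (intro allI impI, rule ccontr)
  fix x y assume y: "y \<in> oc x" and "x \<notin> oc y"
  then obtain W where W: "open W" "compact W" "x \<in> W" "W \<subseteq> - oc y"
    using clopen_neighbourhood[of "- oc y" x] closed_oc by auto
  obtain K where K: "compact K" "\<And>t. \<exists>k\<in>K. act k (act t x) \<in> W"
    using assms[of x] W unfolding almost_periodic_def by (metis interior_open syndeticE)
  \<comment> \<open>\<open>K\<close> keeps \<open>y\<close> off \<open>W\<close>, hence also all
    points near \<open>y\<close>; but some of these lie on the orbit of \<open>x\<close>, which
    \<open>K\<close> returns to \<open>W\<close>.\<close>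
  have "\<forall>\<^sub>F z in nhds y. \<forall>k\<in>K. act k z \<in> - W"
    using W act_in_oc by (intro eventually_act_compact K) (auto simp: compact_imp_closed)
  then obtain V where V: "open V" "y \<in> V" "\<forall>z\<in>V. \<forall>k\<in>K. act k z \<in> - W"
    unfolding eventually_nhds by blast
  then obtain t where "act t x \<in> V" using oc_meets_open[OF y] by blast
  then have "\<forall>k\<in>K. act k (act t x) \<notin> W" using V(3) by blast
  then show False using K(2) by blast
qed

lemma stable_imp_symmetric_orbits: "stable \<Longrightarrow> symmetric_orbits"
  by (intro closed_relation_imp_symmetric_orbits stable_imp_closed_relation)

text \<open>The finite set that returns \<open>oc x\<close> to a small \<open>W\<close> does so on
  an open set. By stability that set contains \<open>oc y\<close> for all \<open>y\<close> near
  \<open>x\<close>, so one \<open>F\<close> serves them all.\<close>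

lemma stable_imp_discrete_lwap:
  assumes stable
  shows "discrete_locally_weakly_almost_periodic act"
  unfolding discrete_locally_weakly_almost_periodic_def
proof (intro allI impI)
  fix \<alpha> :: "('x \<times> 'x) set" and x
  assume "\<forall>\<^sub>F p in uniformity. p \<in> \<alpha>"
  then obtain D where D: "eventually D uniformity"
    "\<And>a b c. D (a, b) \<Longrightarrow> D (b, c) \<Longrightarrow> (a, c) \<in> \<alpha>"
    by (rule uniformity_transE) auto
  \<comment> \<open>Both orders are needed: \<open>D\<close> is chained from \<open>y\<close> to
    \<open>x\<close> and from \<open>x\<close> to the returned point.\<close>
  have "\<forall>\<^sub>F z in nhds x. D (x, z) \<and> D (z, x)"
    unfolding eventually_nhds_uniformity
    using eventually_conj[OF D(1) uniformity_sym[OF D(1)]] by (rule eventually_mono) auto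
  then obtain W where W: "open W" "x \<in> W" "\<And>z. z \<in> W \<Longrightarrow> D (x, z) \<and> D (z, x)"
    unfolding eventually_nhds by blast
  obtain F where F: "finite F" "oc x \<subseteq> {z. \<exists>f\<in>F. act f z \<in> W}"
    using symmetric_orbits_cover[OF stable_imp_symmetric_orbits[OF assms] W(1,2)] by blast
  have "{z. \<exists>f\<in>F. act f z \<in> W} = (\<Union>f\<in>F. {z. act f z \<in> W})" by blast
  then have "open {z. \<exists>f\<in>F. act f z \<in> W}" using open_vimage_act[OF W(1)] by auto
  then obtain N where N: "open N" "x \<in> N" "\<And>y. y \<in> N \<Longrightarrow> oc y \<subseteq> {z. \<exists>f\<in>F. act f z \<in> W}"
    by (rule stable_neighbourhood[OF assms _ F(2)]) blast
  have return: "(\<lambda>f. act f (act t y)) ` F \<inter> \<alpha> `` {y} \<noteq> {}" if y: "y \<in> N \<inter> W" for y t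
  proof -
    obtain f where f: "f \<in> F" "act f (act t y) \<in> W" using N(3)[of y] y act_in_oc by blast
    then have "(y, act f (act t y)) \<in> \<alpha>" using D(2) W(3) y by blast
    with f show ?thesis by blast
  qed
  show "\<exists>F V. finite F \<and> x \<in> interior V \<and>
      (\<forall>y\<in>V. \<forall>t. (\<lambda>f. act f (act t y)) ` F \<inter> \<alpha> `` {y} \<noteq> {})"
  proof (intro exI conjI ballI allI)
    show "finite F" by (rule F(1))
    show "x \<in> interior (N \<inter> W)" using N W by (simp add: interior_open open_Int)
  qed (rule return)
qed

lemma discrete_lwap_imp_almost_periodic:
  assumes "discrete_locally_weakly_almost_periodic act"
  shows "almost_periodic act x"
  unfolding almost_periodic_def
proof (intro allI impI)
  fix U assume "x \<in> interior U"
  then have "\<forall>\<^sub>F z in nhds x. z \<in> interior U" by (intro eventually_nhds_in_open open_interior)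
  then have "\<forall>\<^sub>F z in nhds x. z \<in> U"
    by (rule eventually_mono) (rule subsetD[OF interior_subset])
  \<comment> \<open>This entourage has section \<open>U\<close> at \<open>x\<close> and is
    unrestricted elsewhere.\<close>
  then have "\<forall>\<^sub>F p in uniformity. p \<in> {(x', z). x' = x \<longrightarrow> z \<in> U}"
    unfolding eventually_nhds_uniformity by (simp add: split_def)
  from assms[unfolded discrete_locally_weakly_almost_periodic_def, rule_format, OF this, of x]
  obtain F V where FV: "finite F" "x \<in> interior V"
    "\<forall>y\<in>V. \<forall>t. (\<lambda>f. act f (act t y)) ` F \<inter> {(x', z). x' = x \<longrightarrow> z \<in> U} `` {y} \<noteq> {}"
    by (elim exE conjE)
  have xV: "x \<in> V" by (rule subsetD[OF interior_subset FV(2)])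
  have "g \<in> inverse ` F * {t. act t x \<in> U}" for g
  proof -
    obtain f where f: "f \<in> F" "act f (act g x) \<in> U"
      using FV(3)[rule_format, OF xV, of g] by blast
    then have "inverse f * (f * g) \<in> inverse ` F * {t. act t x \<in> U}"
      by (intro set_times_intro) (auto simp: act_mult)
    then show ?thesis by simp
  qed
  then show "syndetic {t. act t x \<in> U}"
    unfolding syndetic_def using finite_imp_compact[OF FV(1)] by blast
qed

end


section \<open>Recurrence along cones\<close>

locale generated_zero_dimensional_flow =
  compactly_generated \<Gamma> + zero_dimensional_flow act
  for \<Gamma> :: "'g::paratopological_group set"
    and act :: "'g \<Rightarrow> 'x \<Rightarrow> 'x::{uniform_space,t2_space}"
begin

text \<open>
  For \<open>z\<close> near \<open>x\<close> with orbit leaving \<open>U\<close>, \<open>h z\<close> is the inverse of a shortest \<open>g\<close> with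
  \<open>g z \<notin> U\<close>, and \<open>y\<^sub>0\<close> is a cluster point of the first exit points \<open>g z\<close>.
\<close>

lemma escaping_filter:
  assumes U: "compact U" "open U" and "oc x \<subseteq> U" and not_int: "x \<notin> interior {z. oc z \<subseteq> U}"
  obtains F :: "'x filter" and y h y0 where
    "F \<noteq> bot" "filterlim (\<lambda>z. len (h z)) at_top F" "(y \<longlongrightarrow> y0) F" "y0 \<notin> U"
    "\<forall>\<^sub>F z in F. \<forall>c \<in> gamma_K \<Gamma> (h z). act c (y z) \<in> U"
proof -
  have oc_iff: "oc z \<subseteq> U \<longleftrightarrow> (\<forall>t. act t z \<in> U)" for z
    by (rule oc_subset_iff[OF compact_imp_closed[OF U(1)]])
  define B where "B = {z. \<exists>t. act t z \<notin> U}"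
  have "\<exists>g. act g z \<notin> U \<and> (\<forall>s. act s z \<notin> U \<longrightarrow> len g \<le> len s)" if "z \<in> B" for z
    using that ex_has_least_nat[of "\<lambda>t. act t z \<notin> U" _ len] by (auto simp: B_def)
  then obtain g where g: "\<And>z. z \<in> B \<Longrightarrow> act (g z) z \<notin> U"
    and least: "\<And>z s. z \<in> B \<Longrightarrow> act s z \<notin> U \<Longrightarrow> len (g z) \<le> len s" by metis
  define F0 where "F0 = inf (nhds x) (principal B)"
  have "F0 \<noteq> bot"
  proof
    assume "F0 = bot"
    then have "\<forall>\<^sub>F z in nhds x. z \<notin> B"
      by (simp add: F0_def trivial_limit_def eventually_inf_principal)
    then obtain S where "open S" "x \<in> S" "\<forall>z\<in>S. z \<notin> B" unfolding eventually_nhds by blast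
    then show False using not_int interiorI[of S x "{z. oc z \<subseteq> U}"] oc_iff by (auto simp: B_def)
  qed
  have in_B: "\<forall>\<^sub>F z in F0. z \<in> B" by (simp add: F0_def eventually_inf_principal)
  \<comment> \<open>The compact set \<open>\<Gamma> ^ n\<close> moves \<open>x\<close> into
    \<open>U\<close>, hence also every \<open>z\<close> near \<open>x\<close>, so an exit from
    \<open>U\<close> takes a longer word.\<close>
  have far: "\<forall>\<^sub>F z in F0. n < len (g z)" for n
  proof -
    have "\<forall>\<^sub>F z in nhds x. \<forall>c\<in>\<Gamma> ^ n. act c z \<in> U"
      using \<open>oc x \<subseteq> U\<close> oc_iff by (intro eventually_act_compact compact_power U) auto
    then have "\<forall>\<^sub>F z in F0. \<forall>c\<in>\<Gamma> ^ n. act c z \<in> U"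
      unfolding F0_def by (rule filter_leD[OF inf_le1])
    with in_B show ?thesis
      by eventually_elim (use g in \<open>auto simp: len_le_iff not_le[symmetric]\<close>)
  qed
  have inside: "act w z \<in> U" if "z \<in> B" "len w < len (g z)" for z w
    using least[OF that(1), of w] that(2) by fastforce
  \<comment> \<open>First exit points lie here: the letter applied last in a shortest word for
    \<open>g z\<close> carries a point of \<open>U\<close> out of \<open>U\<close>.\<close>
  define K where "K = (\<lambda>(t, z). act t z) ` (\<Gamma> \<times> U) - U"
  have "compact K"
    unfolding K_def using compact_generator U
    by (intro compact_diff compact_continuous_image compact_Times
          continuous_on_subset[OF continuous_act]) auto
  moreover have "\<forall>\<^sub>F z in F0. act (g z) z \<in> K"
    using in_B far[of 0]
  proof eventually_elim
    case (elim z)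
    then have "\<Gamma> ^ len (g z) = \<Gamma> * \<Gamma> ^ (len (g z) - 1)"
      by (cases "len (g z)") auto
    then obtain a w where aw: "g z = a * w" "a \<in> \<Gamma>" "w \<in> \<Gamma> ^ (len (g z) - 1)"
      using mem_power_len[of "g z"] by (auto elim: set_times_elim)
    then have "len w < len (g z)" using elim(2) by (simp add: len_le_iff[symmetric])
    then have "act w z \<in> U" by (rule inside[OF elim(1)])
    then have "(a, act w z) \<in> \<Gamma> \<times> U" using aw by simp
    moreover have "act (g z) z = (\<lambda>(t, z). act t z) (a, act w z)" using aw by (simp add: act_mult)
    ultimately show ?case unfolding K_def using g[OF elim(1)] by blast
  qed
  ultimately obtain y0 where y0: "y0 \<in> K"
    "inf F0 (filtercomap (\<lambda>z. act (g z) z) (nhds y0)) \<noteq> bot" (is "?F \<noteq> bot")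
    by (rule compact_cluster_point[OF _ \<open>F0 \<noteq> bot\<close>])
  have le: "?F \<le> F0" by simp
  show ?thesis
  proof (rule that[of ?F "\<lambda>z. inverse (g z)" "\<lambda>z. act (g z) z" y0])
    show "?F \<noteq> bot" by (rule y0(2))
    show "filterlim (\<lambda>z. len (inverse (g z))) at_top ?F"
      unfolding filterlim_at_top len_inverse
      by (intro allI eventually_mono[OF filter_leD[OF le far]] less_imp_le)
    show "((\<lambda>z. act (g z) z) \<longlongrightarrow> y0) ?F"
      by (rule filterlim_mono[OF filterlim_filtercomap]) auto
    show "y0 \<notin> U" using y0(1) by (simp add: K_def)
    have "\<forall>\<^sub>F z in F0. \<forall>c \<in> gamma_K \<Gamma> (inverse (g z)). act c (act (g z) z) \<in> U"
      using in_B far[of 0]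
    proof eventually_elim
      case (elim z)
      show ?case
      proof
        fix c assume "c \<in> gamma_K \<Gamma> (inverse (g z))"
        \<comment> \<open>The inequality is strict because \<open>far[0]\<close> makes
          \<open>len (g z)\<close> positive.\<close>
        then have "len (c * g z) < len (g z)"
          using elim(2) by (simp add: mem_gamma_K_iff len_inverse)
        then show "act c (act (g z) z) \<in> U"
          unfolding act_mult[symmetric] by (rule inside[OF elim(1)])
      qed
    qed
    then show "\<forall>\<^sub>F z in ?F. \<forall>c \<in> gamma_K \<Gamma> (inverse (g z)). act c (act (g z) z) \<in> U"
      by (rule filter_leD[OF le])
  qed
qed

section \<open>Recurrence implies stability\<close>

lemma stableI:
  assumes "\<And>U x. compact U \<Longrightarrow> open U \<Longrightarrow> oc x \<subseteq> U \<Longrightarrow> x \<notin> interior {z. oc z \<subseteq> U} \<Longrightarrow> False"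
  shows stable
  unfolding stable_def
proof (intro allI impI)
  fix U :: "'x set" assume "compact U \<and> open U"
  then have "interior {z. oc z \<subseteq> U} = {z. oc z \<subseteq> U}"
    using assms interior_subset by blast
  then show "open {z. oc z \<subseteq> U}" by (metis open_interior)
qed

text \<open>Recurrence of \<open>y0\<close> gives \<open>c\<close> in the cone of the escaping
  filter with \<open>act c y0\<close> outside \<open>U\<close>. By joint continuity pairs near
  \<open>(c, y0)\<close> also land outside \<open>U\<close>, although elements of
  \<open>gamma_K \<Gamma> (h z)\<close> come near \<open>c\<close> and map \<open>y z\<close> into
  \<open>U\<close>.\<close>

lemma recurrent_I_imp_stable:
  assumes rec: "\<And>x. gamma_recurrent_I act \<Gamma> x"
  shows stable
proof (rule stableI)
  fix U x assume U: "compact U" "open U" and x: "oc x \<subseteq> U" "x \<notin> interior {z. oc z \<subseteq> U}"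
  obtain F :: "'x filter" and y h y0 where F: "F \<noteq> bot" "filterlim (\<lambda>z. len (h z)) at_top F"
    "(y \<longlongrightarrow> y0) F" "y0 \<notin> U" "\<forall>\<^sub>F z in F. \<forall>c \<in> gamma_K \<Gamma> (h z). act c (y z) \<in> U"
    by (rule escaping_filter[OF U x])
  have cl: "open (- U)" using U(1) by (simp add: compact_imp_closed open_Compl)
  then have "y0 \<in> interior (- U)" using F(4) by (simp add: interior_open)
  then have "(\<lambda>c. act c y0) ` {c. \<forall>W. open W \<longrightarrow> c \<in> W \<longrightarrow>
      (\<exists>\<^sub>F z in F. gamma_K \<Gamma> (h z) \<inter> W \<noteq> {})} \<inter> - U \<noteq> {}"
    using rec[of y0] gamma_cone_filter[OF F(1,2)] unfolding gamma_recurrent_I_def by simp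
  then obtain c where c: "\<And>W. open W \<Longrightarrow> c \<in> W \<Longrightarrow> \<exists>\<^sub>F z in F. gamma_K \<Gamma> (h z) \<inter> W \<noteq> {}"
    and "act c y0 \<in> - U"
    by auto
  then have "(c, y0) \<in> {p. act (fst p) (snd p) \<in> - U}" by simp
  then obtain W N where "open W" "open N" "(c, y0) \<in> W \<times> N"
    "W \<times> N \<subseteq> {p. act (fst p) (snd p) \<in> - U}"
    by (rule open_prod_elim[OF open_act_preimage[OF cl]])
  then have WN: "open W" "open N" "c \<in> W" "y0 \<in> N" "\<And>t z. t \<in> W \<Longrightarrow> z \<in> N \<Longrightarrow> act t z \<notin> U"
    by auto
  have "\<forall>\<^sub>F z in F. y z \<in> N" using F(3) WN by (intro topological_tendstoD)
  with F(5) have "\<forall>\<^sub>F z in F. \<not> gamma_K \<Gamma> (h z) \<inter> W \<noteq> {}"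
    by eventually_elim (use WN(5) in fastforce)
  then show False using c[OF WN(1,3)] by (simp add: frequently_def)
qed

text \<open>The recurrence times vary with \<open>z\<close>, but their bounded length confines them
  to one compact set \<open>Q\<close>. Points near \<open>y0\<close> are moved off \<open>U\<close>
  by all of \<open>Q\<close> at once.\<close>

lemma recurrent_II_imp_stable:
  assumes rec: "\<And>x. gamma_recurrent_II act \<Gamma> x"
  shows stable
proof (rule stableI)
  fix U x assume U: "compact U" "open U" and x: "oc x \<subseteq> U" "x \<notin> interior {z. oc z \<subseteq> U}"
  obtain F :: "'x filter" and y h y0 where F: "F \<noteq> bot" "filterlim (\<lambda>z. len (h z)) at_top F"
    "(y \<longlongrightarrow> y0) F" "y0 \<notin> U" "\<forall>\<^sub>F z in F. \<forall>c \<in> gamma_K \<Gamma> (h z). act c (y z) \<in> U"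
    by (rule escaping_filter[OF U x])
  have cl: "open (- U)" using U(1) by (simp add: compact_imp_closed open_Compl)
  then have "y0 \<in> interior (- U)" using F(4) by (simp add: interior_open)
  then obtain n where
    n: "\<exists>\<^sub>F z in F. \<exists>c. c \<in> gamma_K \<Gamma> (h z) \<and> act c y0 \<in> - U \<and> c \<in> \<Gamma> ^ n"
    by (rule gamma_recurrent_II_filter[OF rec _ F(1,2)])
  define Q where "Q = \<Gamma> ^ n \<inter> {c. act c y0 \<in> - U}"
  have "open {c. act c y0 \<in> U}"
    using open_vimage[OF open_act_preimage[OF U(2)], of "\<lambda>c. (c, y0)"]
    by (simp add: vimage_def continuous_intros)
  then have "closed {c. act c y0 \<in> - U}" by (simp add: closed_def Collect_neg_eq[symmetric])
  then have "compact Q" unfolding Q_def by (intro compact_Int_closed compact_power)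
  then have "\<forall>\<^sub>F v in nhds y0. \<forall>c\<in>Q. act c v \<in> - U"
    by (rule eventually_act_compact[OF _ cl]) (simp add: Q_def)
  then have "\<forall>\<^sub>F z in F. \<forall>c\<in>Q. act c (y z) \<in> - U"
    by (rule eventually_compose_filterlim[OF _ F(3)])
  with F(5) have "\<forall>\<^sub>F z in F. \<not> (\<exists>c. c \<in> gamma_K \<Gamma> (h z) \<and> act c y0 \<in> - U \<and> c \<in> \<Gamma> ^ n)"
    by eventually_elim (auto simp: Q_def)
  then show False using n by (simp add: frequently_def)
qed

section \<open>Symmetry of orbit closures implies recurrence\<close>

lemma symmetric_orbits_return:
  assumes symmetric_orbits "open V" "x \<in> V"
  obtains n where "n \<ge> 1"
    "\<And>h. n \<le> len h \<Longrightarrow> \<exists>c. c \<in> gamma_K \<Gamma> h \<and> act c x \<in> V \<and> c \<in> \<Gamma> ^ n"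
proof -
  obtain F where F: "finite F" "oc x \<subseteq> {z. \<exists>f\<in>F. act f z \<in> V}"
    using symmetric_orbits_cover[OF assms] by blast
  obtain m where m: "F \<subseteq> \<Gamma> ^ m" using finite_subset_power[OF F(1)] by blast
  \<comment> \<open>The time is \<open>f * s\<close> with \<open>f\<close> of length at most
    \<open>m\<close> and \<open>s\<close> of length at most \<open>Suc m\<close>; the same sum as
    lower bound for \<open>len h\<close> ensures \<open>m < len h\<close>.\<close>
  have "\<exists>c. c \<in> gamma_K \<Gamma> h \<and> act c x \<in> V \<and> c \<in> \<Gamma> ^ (m + Suc m)" if h: "m + Suc m \<le> len h" for h
  proof -
    have "m < len h" using h by simp
    then obtain s where s: "s \<in> \<Gamma> ^ Suc m" "\<And>f. f \<in> \<Gamma> ^ m \<Longrightarrow> f * s \<in> gamma_K \<Gamma> h"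
      using gamma_K_contains_translate by blast
    obtain f where f: "f \<in> F" "act f (act s x) \<in> V" using F(2) act_in_oc by blast
    have "f * s \<in> \<Gamma> ^ (m + Suc m)"
      unfolding power_add using f(1) m s(1) by blast
    then show ?thesis using f m s(2) by (intro exI[of _ "f * s"]) (auto simp: act_mult)
  qed
  then show ?thesis by (intro that[of "m + Suc m"]) auto
qed

lemma symmetric_orbits_imp_recurrent_II:
  assumes symmetric_orbits
  shows "gamma_recurrent_II act \<Gamma> x"
  unfolding gamma_recurrent_II_def
proof (intro allI impI)
  fix U and I :: "'g net_index set" and le g
  assume U: "x \<in> interior U" and dir: "directed_set I le"
    and lim: "filterlim (\<lambda>i. len (g i)) at_top (net_filter I le)"
  obtain n where n: "n \<ge> 1"
    "\<And>h. n \<le> len h \<Longrightarrow> \<exists>c. c \<in> gamma_K \<Gamma> h \<and> act c x \<in> interior U \<and> c \<in> \<Gamma> ^ n"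
    using symmetric_orbits_return[OF assms open_interior U] by blast
  have "\<forall>\<^sub>F i in net_filter I le. n \<le> len (g i)" using lim by (simp add: filterlim_at_top)
  then have "\<exists>\<^sub>F i in net_filter I le. n \<le> len (g i)"
    by (intro eventually_frequently net_filter_neq_bot dir)
  then have sub: "subnet_map I le {i \<in> I. n \<le> len (g i)} le (\<lambda>i. i)"
    by (rule frequently_imp_subnet[OF dir])
  define c where "c = (\<lambda>i. SOME c. c \<in> gamma_K \<Gamma> (g i) \<and> act c x \<in> interior U \<and> c \<in> \<Gamma> ^ n)"
  have "c i \<in> gamma_K \<Gamma> (g i) \<and> act (c i) x \<in> interior U \<and> c i \<in> \<Gamma> ^ n" if "n \<le> len (g i)" for i
    unfolding c_def by (rule someI_ex[OF n(2)[OF that]])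
  then have "\<forall>i\<in>{i \<in> I. n \<le> len (g i)}.
      c i \<in> gamma_K \<Gamma> (g i) \<and> act (c i) x \<in> U \<and> len (c i) \<le> n"
    using interior_subset by (auto simp: len_le_iff)
  with sub n(1) show "\<exists>n\<ge>1. \<exists>(J :: 'g net_index set) le' \<phi> c. subnet_map I le J le' \<phi> \<and>
      (\<forall>j\<in>J. c j \<in> gamma_K \<Gamma> (g (\<phi> j)) \<and> act (c j) x \<in> U \<and> len (c j) \<le> n)"
    by blast
qed

text \<open>Return times of bounded length cluster at some \<open>c0\<close> in a compact power of
  \<open>\<Gamma>\<close>; being chosen from the sets \<open>gamma_K \<Gamma> (g i)\<close>, they
  force \<open>c0\<close> into the cone.\<close>

lemma symmetric_orbits_imp_recurrent_I:
  assumes symmetric_orbits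
  shows "gamma_recurrent_I act \<Gamma> x"
  unfolding gamma_recurrent_I_def
proof (intro allI impI)
  fix C U assume "gamma_cone \<Gamma> C" and U: "x \<in> interior U"
  then obtain I :: "'g net_index set" and le g where dir: "directed_set I le"
    and lim: "filterlim (\<lambda>i. len (g i)) at_top (net_filter I le)"
    and C: "set_net_limit I le (\<lambda>i. gamma_K \<Gamma> (g i)) C"
    unfolding gamma_cone_def by blast
  \<comment> \<open>\<open>V\<close> is compact, hence closed, so that \<open>act c0 x\<close> stays
    in \<open>V\<close> in the limit.\<close>
  obtain V where V: "open V" "compact V" "x \<in> V" "V \<subseteq> interior U"
    using clopen_neighbourhood[OF open_interior U] by blast
  obtain n where n:
    "\<And>h. n \<le> len h \<Longrightarrow> \<exists>c. c \<in> gamma_K \<Gamma> h \<and> act c x \<in> V \<and> c \<in> \<Gamma> ^ n"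
    using symmetric_orbits_return[OF assms V(1,3)] by blast
  define c where "c = (\<lambda>i. SOME c. c \<in> gamma_K \<Gamma> (g i) \<and> act c x \<in> V \<and> c \<in> \<Gamma> ^ n)"
  have c: "c i \<in> gamma_K \<Gamma> (g i) \<and> act (c i) x \<in> V \<and> c i \<in> \<Gamma> ^ n" if "n \<le> len (g i)" for i
    unfolding c_def by (rule someI_ex[OF n[OF that]])
  have large: "\<forall>\<^sub>F i in net_filter I le. n \<le> len (g i)" using lim by (simp add: filterlim_at_top)
  then have "\<forall>\<^sub>F i in net_filter I le. c i \<in> \<Gamma> ^ n" by (rule eventually_mono) (use c in blast)
  then obtain c0 where c0: "inf (net_filter I le) (filtercomap c (nhds c0)) \<noteq> bot" (is "?F \<noteq> bot")
    using compact_cluster_point[OF compact_power net_filter_neq_bot[OF dir]] by blast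
  have lim0: "(c \<longlongrightarrow> c0) ?F" by (rule filterlim_mono[OF filterlim_filtercomap]) auto
  have large': "\<forall>\<^sub>F i in ?F. n \<le> len (g i)" by (rule filter_leD[OF inf_le1 large])
  have "c0 \<in> C"
  proof -
    have "\<exists>\<^sub>F i in net_filter I le. gamma_K \<Gamma> (g i) \<inter> W \<noteq> {}" if W: "open W" "c0 \<in> W" for W
    proof -
      have "\<forall>\<^sub>F i in ?F. c i \<in> W" using lim0 W by (intro topological_tendstoD)
      with large' have "\<forall>\<^sub>F i in ?F. gamma_K \<Gamma> (g i) \<inter> W \<noteq> {}"
        by eventually_elim (use c in blast)
      then have "\<exists>\<^sub>F i in ?F. gamma_K \<Gamma> (g i) \<inter> W \<noteq> {}"
        by (rule eventually_frequently[OF c0])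
      then show ?thesis
        unfolding frequently_def using filter_leD[OF inf_le1] by blast
    qed
    then show ?thesis using C unfolding set_net_limit_iff[OF dir] by blast
  qed
  moreover have "act c0 x \<in> V"
  proof (rule ccontr)
    assume "act c0 x \<notin> V"
    moreover have "open {c. act c x \<in> - V}"
      using open_vimage[OF open_act_preimage[of "- V"], of "\<lambda>c. (c, x)"] V(2)
      by (simp add: vimage_def continuous_intros compact_imp_closed open_Compl)
    ultimately have "\<forall>\<^sub>F i in ?F. c i \<in> {c. act c x \<in> - V}"
      using lim0 by (intro topological_tendstoD) auto
    with large' have "\<forall>\<^sub>F i in ?F. False" by eventually_elim (use c in auto)
    then show False using c0 by (simp add: trivial_limit_def)
  qed
  ultimately show "(\<lambda>c. act c x) ` C \<inter> U \<noteq> {}" using V(4) interior_subset by blast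
qed

end

theorem theorem3:
  fixes act :: "'g::paratopological_group \<Rightarrow> 'x \<Rightarrow> 'x::{uniform_space,t2_space}"
    and \<Gamma> :: "'g set"
  assumes "flow act"
    and "compactly_generated_by \<Gamma>"
    and "zero_dimensional TYPE('x)"
  shows "((\<forall>x. gamma_recurrent_I act \<Gamma> x) \<longleftrightarrow> (\<forall>x. gamma_recurrent_II act \<Gamma> x)) \<and>
    ((\<forall>x. gamma_recurrent_I act \<Gamma> x) \<longleftrightarrow> (\<forall>x. almost_periodic act x)) \<and>
    ((\<forall>x. gamma_recurrent_I act \<Gamma> x) \<longleftrightarrow>
      (\<exists>M. (\<forall>K\<in>M. minimal_set act K) \<and> \<Union>M = UNIV)) \<and>
    ((\<forall>x. gamma_recurrent_I act \<Gamma> x) \<longleftrightarrow> closed {(x, y). y \<in> orbit_closure act x}) \<and>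
    ((\<forall>x. gamma_recurrent_I act \<Gamma> x) \<longleftrightarrow> orbit_closure_continuous act) \<and>
    ((\<forall>x. gamma_recurrent_I act \<Gamma> x) \<longleftrightarrow> orbit_closure_usc act) \<and>
    ((\<forall>x. gamma_recurrent_I act \<Gamma> x) \<longleftrightarrow>
      (\<forall>U. compact U \<and> open U \<longrightarrow>
         compact {x. orbit_closure act x \<subseteq> U} \<and> open {x. orbit_closure act x \<subseteq> U})) \<and>
    ((\<forall>x. gamma_recurrent_I act \<Gamma> x) \<longleftrightarrow> discrete_locally_weakly_almost_periodic act)"
proof -
  interpret generated_zero_dimensional_flow \<Gamma> act
    using assms by unfold_locales
  show ?thesis
    \<comment> \<open>Either recurrence implies \<open>stable\<close>, which implies
      \<open>symmetric_orbits\<close>, which implies both recurrences. Every other condition is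
      implied by \<open>stable\<close> and implies \<open>symmetric_orbits\<close>.\<close>
    unfolding union_of_minimal_sets_iff stable_iff[symmetric]
    using recurrent_I_imp_stable recurrent_II_imp_stable stable_imp_symmetric_orbits
      symmetric_orbits_imp_recurrent_I symmetric_orbits_imp_recurrent_II
      symmetric_orbits_imp_almost_periodic almost_periodic_imp_symmetric_orbits
      stable_imp_closed_relation closed_relation_imp_symmetric_orbits
      stable_imp_orbit_closure_continuous orbit_closure_continuous_imp_symmetric_orbits
      stable_iff_usc stable_imp_discrete_lwap discrete_lwap_imp_almost_periodic
    by metis
qed

end
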